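(* Consider the controlled Markov chain $(\mathbb{X},\mathbb{U},\mathcal{U},\mathcal{T},c)$ described in the context. Suppose that: (i) $\mathcal{G}$ is weakly compact; $\mathbb{X}=\mathbb{R}^n$ for some finite $n$; and $\mathcal{U}(x)=\mathbb{U}$ is compact for all $x\in\mathbb{X}$. (ii) For some $\alpha\in[0,1)$, under every stationary policy $\gamma\in\Gamma_{\mathsf S}$, the map $P^\gamma(\pi)(\cdot)=\int\pi(dx)\int\gamma(du\mid x)\,\mathcal{T}(\cdot\mid x,u)$ satisfies $$\|P^\gamma(\pi)-P^\gamma(\bar\pi)\|_{\mathsf{TV}}\le\alpha\,\|\pi-\bar\pi\|_{\mathsf{TV}}$$ for every pair of probability measures $\pi,\bar\pi$ on $\mathbb{X}$. (In particular every stationary policy leads to a unique invariant probability measure.) (iii) The probability measures $\mathcal{T}(dy\mid x,u)$, $x\in\mathbb{X}$, $u\in\mathbb{U}$, admit densities $f_{x,u}(y)$ with respect to a reference measure, and all these densities are bounded and equicontinuous (over $x\in\mathbb{X}$, $u\in\mathbb{U}$). (iv) One of the following holds: (H1) holds and the cost function $c$ is bounded and continuous; or (H2)(a) holds and the cost function $c$ is bounded and $u\mapsto c(x,u)$ is continuous for every $x$. Then deterministic stationary policies are dense among randomized stationary policies in terms of cost: for every $\gamma\in\Gamma_{\mathsf S}$ and every $\varepsilon>0$ there exists a deterministic stationary policy $f\in\Gamma_{\mathsf{SD}}$ with $|J(x,f)-J(x,\gamma)|<\varepsilon$ for every $x\in\mathbb{X}$. Furthermore, $f$ can be taken to have finite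 range.
   Context: **Model.** The state space $\mathbb{X}$ and action space $\mathbb{U}$ are Borel subsets of Polish spaces; $\mathcal{B}(\cdot)$ denotes the Borel $\sigma$-field and $\mathcal{P}(\cdot)$ the set of Borel probability measures. $\mathcal{U}:\mathbb{X}\to\mathcal{B}(\mathbb{U})$ gives the admissible actions, and $\mathbb{K}=\{(x,u): x\in\mathbb{X},\,u\in\mathcal{U}(x)\}$ (here $\mathbb{K}=\mathbb{X}\times\mathbb{U}$). $\mathcal{T}(\cdot\mid x,u)$ is a stochastic kernel on $\mathbb{X}$ given $\mathbb{K}$. The one-stage cost $c:\mathbb{K}\to\mathbb{R}_+$ is measurable. $\Gamma_{\mathsf S}$ is the set of stationary (possibly randomized) policies, i.e. stochastic kernels $\gamma(\cdot\mid x)$ on $\mathbb{U}$ given $\mathbb{X}$ with $\gamma(\mathcal{U}(x)\mid x)=1$; $\Gamma_{\mathsf{SD}}$ is the subset of deterministic ones, identified with measurable maps $f:\mathbb{X}\to\mathbb{U}$ with $f(x)\in\mathcal{U}(x)$. Under $\gamma\in\Gamma_{\mathsf S}$ the process satisfies $U_t\sim\gamma(\cdot\mid X_t)$ and $X_{t+1}\sim\mathcal{T}(\cdot\mid X_t,U_t)$ given the past, and $\mathbb{E}^\gamma_x$ is expectation when $X_0=x$. Average cost: $J(x,\gamma)=\limsup_{T\to\infty}\frac1T\mathbb{E}^\gamma_x\big[\sum_{t=0}^{T-1}c(X_t,U_t)\big]$. The set of invariant occupation measures is $$\mathcal{G}=\Big\{\mu\in\mathcal{P}(\mathbb{K}):\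 \mu(B\times\mathbb{U})=\int_{\mathbb{K}}\mathcal{T}(B\mid x,u)\,\mu(dx,du)\ \ \forall B\in\mathcal{B}(\mathbb{X})\Big\}.$$ $\|\cdot\|_{\mathsf{TV}}$ is the total variation norm. (H1): $(x,u)\mapsto\int f(z)\,\mathcal{T}(dz\mid x,u)$ is continuous on $\mathbb{K}$ for every bounded continuous $f:\mathbb{X}\to\mathbb{R}$. (H2)(a): for every $x\in\mathbb{X}$ and every bounded measurable $f:\mathbb{X}\to\mathbb{R}$, $u\mapsto\int f(z)\,\mathcal{T}(dz\mid x,u)$ is continuous.
   Formalization: The reference measure is additionally assumed to give mass zero to every single point (so n ≥ 1); with atoms the claim fails, e.g. reference measure and all transition laws equal to the point mass at 0, U={0,1}, c(x,u)=u. *)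

theory Defs
  imports "HOL-Probability.Probability"
begin

text \<open>
  The state space is a whole type \<open>'x\<close>, the action space a Borel set \<open>U\<close> in a Polish type
  \<open>'u\<close>, and every action is admissible in every state, so that the set of admissible pairs is
  \<open>UNIV \<times> U\<close>. Stochastic kernels are measurable maps into \<^const>\<open>prob_algebra\<close>; the values of
  kernels and costs outside \<open>UNIV \<times> U\<close> play no role.
\<close>

abbreviation act_space :: "'u::polish_space set \<Rightarrow> 'u measure" where
  "act_space U \<equiv> restrict_space borel U"

abbreviation sa_space :: "'u::polish_space set \<Rightarrow> ('x::polish_space \<times> 'u) measure" where
  "sa_space U \<equiv> restrict_space borel (UNIV \<times> U)"

definition transition_kernel ::
  "'u::polish_space set \<Rightarrow> ('x::polish_space \<times> 'u \<Rightarrow> 'x measure) \<Rightarrow> bool" where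
  "transition_kernel U T \<longleftrightarrow> T \<in> sa_space U \<rightarrow>\<^sub>M prob_algebra borel"

text \<open>The constraint \<open>\<gamma>(U | x) = 1\<close> is part of \<open>\<gamma> x\<close> being a probability measure on \<open>U\<close>.\<close>

definition stationary_policies ::
  "'u::polish_space set \<Rightarrow> ('x::polish_space \<Rightarrow> 'u measure) set" where
  "stationary_policies U = borel \<rightarrow>\<^sub>M prob_algebra (act_space U)"

definition deterministic_policies ::
  "'u::polish_space set \<Rightarrow> ('x::polish_space \<Rightarrow> 'u) set" where
  "deterministic_policies U = borel \<rightarrow>\<^sub>M act_space U"

definition dirac_policy ::
  "'u::polish_space set \<Rightarrow> ('x::polish_space \<Rightarrow> 'u) \<Rightarrow> 'x \<Rightarrow> 'u measure" where
  "dirac_policy U f = (\<lambda>x. return (act_space U) (f x))"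

lemma dirac_policy_stationary:
  assumes "f \<in> deterministic_policies U"
  shows "dirac_policy U f \<in> stationary_policies U"
  using assms unfolding deterministic_policies_def dirac_policy_def stationary_policies_def
  by (intro measurable_prob_algebraI)
     (auto intro!: prob_space_return measurable_compose[OF _ return_measurable]
           dest: measurable_space)

text \<open>
  The law of the process \<open>t \<mapsto> (X\<^sub>t, U\<^sub>t)\<close> under a stationary policy, with \<open>X\<^sub>0 = x\<close>, is built on
  the trajectory space by the Ionescu-Tulcea theorem: \<open>(X\<^sub>0, U\<^sub>0)\<close> has law
  \<open>\<delta>\<^sub>x \<otimes> \<gamma>\<close>, and given the past up to time \<open>n\<close>, first \<open>X\<^sub>n\<^sub>+\<^sub>1\<close> has law
  \<open>T (X\<^sub>n, U\<^sub>n)\<close> and then \<open>U\<^sub>n\<^sub>+\<^sub>1\<close> has law \<open>\<gamma>(X\<^sub>n\<^sub>+\<^sub>1)\<close>.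
\<close>

definition with_action ::
  "'u::polish_space set \<Rightarrow> ('x::polish_space \<Rightarrow> 'u measure) \<Rightarrow> 'x \<Rightarrow> ('x \<times> 'u) measure" where
  "with_action U \<gamma> x = distr (\<gamma> x) (sa_space U) (\<lambda>u. (x, u))"

fun step_kernel ::
  "'u::polish_space set \<Rightarrow> ('x::polish_space \<times> 'u \<Rightarrow> 'x measure) \<Rightarrow> ('x \<Rightarrow> 'u measure) \<Rightarrow> 'x
   \<Rightarrow> nat \<Rightarrow> (nat \<Rightarrow> 'x \<times> 'u) \<Rightarrow> ('x \<times> 'u) measure" where
  "step_kernel U T \<gamma> x 0 = (\<lambda>h. with_action U \<gamma> x)"
| "step_kernel U T \<gamma> x (Suc n) = (\<lambda>h. T (h n) \<bind> with_action U \<gamma>)"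

definition trajectory_law ::
  "'u::polish_space set \<Rightarrow> ('x::polish_space \<times> 'u \<Rightarrow> 'x measure) \<Rightarrow> ('x \<Rightarrow> 'u measure) \<Rightarrow> 'x
   \<Rightarrow> (nat \<Rightarrow> 'x \<times> 'u) measure" where
  "trajectory_law U T \<gamma> x =
     projective_family.lim UNIV
       (Ionescu_Tulcea.CI (step_kernel U T \<gamma> x) (\<lambda>_. sa_space U)) (\<lambda>_. sa_space U)"

lemma with_action_measurable:
  fixes \<gamma> :: "'a::polish_space \<Rightarrow> 'b::polish_space measure"
  assumes "\<gamma> \<in> stationary_policies U"
  shows "with_action U \<gamma> \<in> borel \<rightarrow>\<^sub>M prob_algebra (sa_space U)"
proof -
  have g: "\<gamma> \<in> borel \<rightarrow>\<^sub>M prob_algebra (act_space U)"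
    using assms by (simp add: stationary_policies_def)
  have "(\<lambda>p. (fst p, snd p)) \<in> borel \<Otimes>\<^sub>M act_space U \<rightarrow>\<^sub>M (borel :: ('a \<times> 'b) measure)"
    unfolding borel_prod[symmetric]
    by (intro measurable_Pair measurable_fst measurable_compose[OF measurable_snd]
              measurable_restrict_space1) simp
  then have m: "(\<lambda>(x, u). (x, u)) \<in> borel \<Otimes>\<^sub>M act_space U \<rightarrow>\<^sub>M (sa_space U :: ('a \<times> 'b) measure)"
    by (intro measurable_restrict_space2)
       (auto simp: space_pair_measure space_restrict_space split_beta')
  have "prob_space (with_action U \<gamma> x)" for x
  proof -
    have gx: "prob_space (\<gamma> x)" "sets (\<gamma> x) = sets (act_space U)"
      using measurable_space[OF g, of x] by (auto simp: space_prob_algebra)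
    have "Pair x \<in> \<gamma> x \<rightarrow>\<^sub>M sa_space U"
      using measurable_compose[OF measurable_Pair1' m, of x] gx(2)
      by (simp add: measurable_cong_sets[OF gx(2) refl])
    then show ?thesis
      unfolding with_action_def by (rule prob_space.prob_space_distr[OF gx(1)])
  qed
  moreover have "with_action U \<gamma> \<in> borel \<rightarrow>\<^sub>M subprob_algebra (sa_space U)"
    unfolding with_action_def[abs_def]
    by (rule measurable_distr2[OF _ measurable_prob_algebraD[OF g]]) (use m in simp)
  ultimately show ?thesis
    by (intro measurable_prob_algebraI) auto
qed

lemma Ionescu_Tulcea_step_kernel:
  assumes "transition_kernel U T" "\<gamma> \<in> stationary_policies U"
  shows "Ionescu_Tulcea (step_kernel U T \<gamma> x) (\<lambda>_. sa_space U)"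
proof -
  have *: "step_kernel U T \<gamma> x n \<in> PiM {0..<n} (\<lambda>_. sa_space U) \<rightarrow>\<^sub>M prob_algebra (sa_space U)"
    for n
  proof (cases n)
    case 0
    have "with_action U \<gamma> x \<in> space (prob_algebra (sa_space U))"
      using measurable_space[OF with_action_measurable[OF assms(2)]] by simp
    then have "(\<lambda>h. step_kernel U T \<gamma> x 0 h)
        \<in> PiM {0..<n} (\<lambda>_. sa_space U) \<rightarrow>\<^sub>M prob_algebra (sa_space U)"
      by simp
    then show ?thesis using 0 by simp
  next
    case (Suc m)
    have "(\<lambda>h. T (h m)) \<in> PiM {0..<n} (\<lambda>_. sa_space U) \<rightarrow>\<^sub>M prob_algebra borel"
      using assms(1) unfolding transition_kernel_def Suc
      by (intro measurable_compose[OF measurable_component_singleton]) auto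
    from measurable_bind_prob_space[OF this with_action_measurable[OF assms(2)]]
    have "(\<lambda>h. step_kernel U T \<gamma> x (Suc m) h)
        \<in> PiM {0..<n} (\<lambda>_. sa_space U) \<rightarrow>\<^sub>M prob_algebra (sa_space U)"
      by simp
    then show ?thesis using Suc by simp
  qed
  show ?thesis
  proof (rule Ionescu_Tulcea.intro)
    show "step_kernel U T \<gamma> x n \<in> PiM {0..<n} (\<lambda>_. sa_space U) \<rightarrow>\<^sub>M subprob_algebra (sa_space U)" for n
      using * by (rule measurable_prob_algebraD)
    show "prob_space (step_kernel U T \<gamma> x n h)" if "h \<in> space (PiM {0..<n} (\<lambda>_. sa_space U))" for n h
      using measurable_space[OF * that] by (simp add: space_prob_algebra)
  qed
qed

text \<open>
  Costs are nonnegative, so expectations are taken in \<^typ>\<open>ennreal\<close> and the average cost is an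
  extended real; the quotient at \<open>m = 0\<close> is irrelevant for the limit superior.
\<close>

definition avg_cost ::
  "'u::polish_space set \<Rightarrow> ('x::polish_space \<times> 'u \<Rightarrow> 'x measure) \<Rightarrow> ('x \<times> 'u \<Rightarrow> real)
   \<Rightarrow> 'x \<Rightarrow> ('x \<Rightarrow> 'u measure) \<Rightarrow> ereal" where
  "avg_cost U T c x \<gamma> =
     limsup (\<lambda>m. enn2ereal (\<integral>\<^sup>+ \<omega>. ennreal (\<Sum>t<m. c (\<omega> t)) \<partial>trajectory_law U T \<gamma> x) / ereal (real m))"

definition invariant_occupation_measures ::
  "'u::polish_space set \<Rightarrow> ('x::polish_space \<times> 'u \<Rightarrow> 'x measure) \<Rightarrow> ('x \<times> 'u) measure set" where
  "invariant_occupation_measures U T =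
     {\<mu> \<in> space (prob_algebra (sa_space U)).
        \<forall>B\<in>sets borel. emeasure \<mu> (B \<times> U) = (\<integral>\<^sup>+ k. emeasure (T k) B \<partial>\<mu>)}"

text \<open>
  The weak topology on the Borel probability measures on \<open>S\<close>: the coarsest one making
  \<open>\<mu> \<mapsto> \<integral>g d\<mu>\<close> continuous for all bounded continuous \<open>g : S \<rightarrow> \<real>\<close>.
\<close>

definition weak_topology :: "'a::topological_space set \<Rightarrow> 'a measure topology" where
  "weak_topology S = topology_generated_by
     {{\<mu> \<in> space (prob_algebra (restrict_space borel S)). (\<integral>z. g z \<partial>\<mu>) \<in> W} |
        (g :: 'a \<Rightarrow> real) W. continuous_on S g \<and> bounded (g ` S) \<and> open W}"

lemma topspace_weak_topology:
  "topspace (weak_topology S) = space (prob_algebra (restrict_space borel S))"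
proof
  show "space (prob_algebra (restrict_space borel S)) \<subseteq> topspace (weak_topology S)"
    unfolding weak_topology_def topology_generated_by_topspace
    by (rule Union_upper, rule CollectI, rule exI[of _ "\<lambda>_. 0"], rule exI[of _ UNIV])
       (auto simp: bounded_def)
qed (auto simp: weak_topology_def)

text \<open>The total variation norm of \<open>\<mu> - \<nu>\<close>, for finite measures on the same \<open>\<sigma>\<close>-algebra.\<close>

definition tv_dist :: "'a measure \<Rightarrow> 'a measure \<Rightarrow> real" where
  "tv_dist \<mu> \<nu> =
     (SUP g\<in>{g \<in> borel_measurable \<mu>. \<forall>z. \<bar>g z\<bar> \<le> 1}. \<bar>(\<integral>z. g z \<partial>\<mu>) - (\<integral>z. g z \<partial>\<nu>)\<bar>)"

definition policy_operator ::
  "('x::polish_space \<times> 'u::polish_space \<Rightarrow> 'x measure) \<Rightarrow> ('x \<Rightarrow> 'u measure)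
   \<Rightarrow> 'x measure \<Rightarrow> 'x measure" where
  "policy_operator T \<gamma> \<pi> = \<pi> \<bind> (\<lambda>x. \<gamma> x \<bind> (\<lambda>u. T (x, u)))"

definition H1 ::
  "'u::polish_space set \<Rightarrow> ('x::polish_space \<times> 'u \<Rightarrow> 'x measure) \<Rightarrow> bool" where
  "H1 U T \<longleftrightarrow> (\<forall>g :: 'x \<Rightarrow> real. continuous_on UNIV g \<and> bounded (range g)
     \<longrightarrow> continuous_on (UNIV \<times> U) (\<lambda>k. \<integral>z. g z \<partial>T k))"

definition H2a ::
  "'u::polish_space set \<Rightarrow> ('x::polish_space \<times> 'u \<Rightarrow> 'x measure) \<Rightarrow> bool" where
  "H2a U T \<longleftrightarrow> (\<forall>x. \<forall>g :: 'x \<Rightarrow> real. g \<in> borel_measurable borel \<and> bounded (range g)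
     \<longrightarrow> continuous_on U (\<lambda>u. \<integral>z. g z \<partial>T (x, u)))"

definition equicontinuous_family :: "'i set \<Rightarrow> ('i \<Rightarrow> 'a::metric_space \<Rightarrow> real) \<Rightarrow> bool" where
  "equicontinuous_family I F \<longleftrightarrow>
     (\<forall>y. \<forall>\<epsilon>>0. \<exists>\<delta>>0. \<forall>y'. dist y' y < \<delta> \<longrightarrow> (\<forall>i\<in>I. \<bar>F i y' - F i y\<bar> < \<epsilon>))"

end

theory Submission
  imports Defs
begin

text \<open>
  Fix a randomized policy \<open>\<gamma>\<close>. The contraction makes the chain forget its initial state
  geometrically fast, so the average cost under any policy \<open>\<gamma>'\<close> can be read off from any law
  \<open>\<pi>\<close> that is almost invariant under \<open>\<gamma>'\<close>: if one step of the chain moves \<open>\<pi>\<close> by at most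
  \<open>d\<close> in total variation, then the average cost from every initial state is within
  \<open>C d / (1 - \<alpha>)\<close> of the one-stage cost expected under \<open>\<pi>\<close>, where \<open>C\<close> bounds the cost
  (\<open>avg_cost_near_act_law_integral\<close>). The iterate \<open>\<pi> = P\<^sup>n \<delta>\<^sub>0\<close> of the operator \<open>P\<close> of \<open>\<gamma>\<close>
  takes the place of the invariant measure: it is almost invariant once \<open>n\<close> is large.

  It remains to find a deterministic \<open>f\<close> of finite range that, when the state has the law \<open>\<pi>\<close>,
  gives nearly the same expected cost as \<open>\<gamma>\<close> and nearly the same law of the next state. Then \<open>\<pi>\<close>
  is almost invariant under \<open>f\<close> as well, and both average costs are close to two numbers that
  are close to each other.

  Nearness of the next-state laws in total variation involves infinitely many test functions.
  Since the transition densities are equicontinuous, on a compact set carrying almost all the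
  mass every test function acts on all transition laws at once like a combination, with
  coefficients in \<open>[-1, 1]\<close>, of finitely many fixed continuous bumps \<open>g\<^sub>y\<close>
  (\<open>equicontinuous_densities_test_functions\<close>, \<open>tv_dist_policy_operator_le\<close>). So \<open>f\<close> has to match
  \<open>\<gamma>\<close> only in the integrals of finitely many functions of the state-action pair: the cost, and
  the expectation of each \<open>g\<^sub>y\<close> at the next state. All of these are bounded, and continuous in
  the action.

  Such an \<open>f\<close> exists because \<open>\<pi>\<close> has no atoms, its transition densities being taken against a
  measure that does not charge points. By continuity \<open>\<gamma>\<close> may be replaced by a randomization over
  finitely many actions, with weights \<open>w\<^sub>i(x)\<close>. Cut the state space into cells on which the finitely
  many functions are almost constant, and split each cell \<open>Q\<close> into pieces of mass
  \<open>\<integral>\<^sub>Q w\<^sub>i d\<pi>\<close>, which an atomless measure permits; on the \<open>i\<close>-th piece, \<open>f\<close> takes the \<open>i\<close>-th action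
  (\<open>atomless_purification\<close>, \<open>deterministic_approximation\<close>).
\<close>
section \<open>Total variation\<close>

lemma prob_algebra_borelD:
  assumes "\<pi> \<in> space (prob_algebra borel)"
  shows "prob_space \<pi>" "sets \<pi> = sets borel" "space \<pi> = UNIV"
  using assms sets_eq_imp_space_eq[of \<pi> borel] by (auto simp: space_prob_algebra)

lemma abs_integral_le_bound:
  fixes g :: "'a \<Rightarrow> real"
  assumes "prob_space M" "\<And>z. z \<in> space M \<Longrightarrow> \<bar>g z\<bar> \<le> B"
  shows "\<bar>\<integral>z. g z \<partial>M\<bar> \<le> B"
proof -
  interpret prob_space M by fact
  have "0 \<le> B" using assms(2) not_empty by force
  show ?thesis
  proof (cases "integrable M g")
    case True
    then have "-B \<le> (\<integral>z. g z \<partial>M)" "(\<integral>z. g z \<partial>M) \<le> B"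
      using assms(2) by (force intro!: integral_ge_const integral_le_const AE_I2 simp: abs_le_iff)+
    then show ?thesis by simp
  qed (use \<open>0 \<le> B\<close> in \<open>simp add: not_integrable_integral_eq\<close>)
qed

lemma integrable_bounded_prob:
  fixes g :: "'a \<Rightarrow> real"
  assumes "prob_space M" "g \<in> borel_measurable M" "\<And>z. z \<in> space M \<Longrightarrow> \<bar>g z\<bar> \<le> B"
  shows "integrable M g"
proof -
  interpret prob_space M by fact
  show ?thesis using assms by (intro integrable_const_bound[where B=B]) (auto intro!: AE_I2)
qed

lemma abs_integral_le_integral:
  fixes f g :: "'a \<Rightarrow> real"
  assumes "integrable M f" "integrable M g" "\<And>x. \<bar>f x\<bar> \<le> g x"
  shows "\<bar>\<integral>x. f x \<partial>M\<bar> \<le> (\<integral>x. g x \<partial>M)"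
proof -
  have "\<bar>\<integral>x. f x \<partial>M\<bar> \<le> (\<integral>x. \<bar>f x\<bar> \<partial>M)" by (rule integral_abs_bound)
  also have "\<dots> \<le> (\<integral>x. g x \<partial>M)" using assms by (intro integral_mono) auto
  finally show ?thesis .
qed

lemma tv_dist_le:
  assumes "\<And>g. g \<in> borel_measurable \<mu> \<Longrightarrow> \<forall>z. \<bar>g z\<bar> \<le> 1 \<Longrightarrow>
             \<bar>(\<integral>z. g z \<partial>\<mu>) - (\<integral>z. g z \<partial>\<nu>)\<bar> \<le> d"
  shows "tv_dist \<mu> \<nu> \<le> d"
  unfolding tv_dist_def
proof (rule cSUP_least)
  have "(\<lambda>_. 0) \<in> {g \<in> borel_measurable \<mu>. \<forall>z. \<bar>g z\<bar> \<le> (1::real)}" by simp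
  then show "{g \<in> borel_measurable \<mu>. \<forall>z. \<bar>g z\<bar> \<le> (1::real)} \<noteq> {}" by blast
qed (use assms in auto)

lemma abs_integral_diff_le_tv_dist:
  assumes "prob_space \<mu>" "prob_space \<nu>" "g \<in> borel_measurable \<mu>" "\<And>z. \<bar>g z\<bar> \<le> 1"
  shows "\<bar>(\<integral>z. g z \<partial>\<mu>) - (\<integral>z. g z \<partial>\<nu>)\<bar> \<le> tv_dist \<mu> \<nu>"
  unfolding tv_dist_def
proof (rule cSUP_upper)
  show "bdd_above ((\<lambda>g. \<bar>(\<integral>z. g z \<partial>\<mu>) - (\<integral>z. g z \<partial>\<nu>)\<bar>) `
    {g \<in> borel_measurable \<mu>. \<forall>z. \<bar>g z\<bar> \<le> (1::real)})"
    unfolding bdd_above_def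
  proof (rule exI[of _ 2], clarify)
    fix g assume "g \<in> borel_measurable \<mu>" "\<forall>z. \<bar>g z\<bar> \<le> (1::real)"
    then show "\<bar>(\<integral>z. g z \<partial>\<mu>) - (\<integral>z. g z \<partial>\<nu>)\<bar> \<le> 2"
      using abs_integral_le_bound[of \<mu> g 1] abs_integral_le_bound[of \<nu> g 1] assms(1,2) by force
  qed
qed (use assms in auto)

lemma tv_dist_le_2:
  assumes "prob_space \<mu>" "prob_space \<nu>"
  shows "tv_dist \<mu> \<nu> \<le> 2"
proof (rule tv_dist_le)
  fix g assume "g \<in> borel_measurable \<mu>" "\<forall>z. \<bar>g z\<bar> \<le> (1::real)"
  then show "\<bar>(\<integral>z. g z \<partial>\<mu>) - (\<integral>z. g z \<partial>\<nu>)\<bar> \<le> 2"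
    using abs_integral_le_bound[of \<mu> g 1] abs_integral_le_bound[of \<nu> g 1] assms by force
qed

lemma tv_dist_triangle:
  assumes "prob_space \<mu>" "prob_space \<nu>" "prob_space \<kappa>" "sets \<mu> = sets \<nu>"
  shows "tv_dist \<mu> \<kappa> \<le> tv_dist \<mu> \<nu> + tv_dist \<nu> \<kappa>"
proof (rule tv_dist_le)
  fix g assume g: "g \<in> borel_measurable \<mu>" "\<forall>z. \<bar>g z\<bar> \<le> (1::real)"
  then have "g \<in> borel_measurable \<nu>"
    unfolding measurable_cong_sets[OF assms(4)[symmetric] refl] by simp
  then show "\<bar>(\<integral>z. g z \<partial>\<mu>) - (\<integral>z. g z \<partial>\<kappa>)\<bar> \<le> tv_dist \<mu> \<nu> + tv_dist \<nu> \<kappa>"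
    using abs_integral_diff_le_tv_dist[of \<mu> \<nu> g] abs_integral_diff_le_tv_dist[of \<nu> \<kappa> g] g assms
    by force
qed

lemma abs_integral_diff_le_tv_dist_scaled:
  assumes "prob_space \<mu>" "prob_space \<nu>" "g \<in> borel_measurable \<mu>" "\<And>z. \<bar>g z\<bar> \<le> C" "0 < C"
  shows "\<bar>(\<integral>z. g z \<partial>\<mu>) - (\<integral>z. g z \<partial>\<nu>)\<bar> \<le> C * tv_dist \<mu> \<nu>"
proof -
  have "\<bar>(\<integral>z. g z / C \<partial>\<mu>) - (\<integral>z. g z / C \<partial>\<nu>)\<bar> \<le> tv_dist \<mu> \<nu>"
    using assms by (intro abs_integral_diff_le_tv_dist) auto
  moreover have "(\<integral>z. g z / C \<partial>\<mu>) - (\<integral>z. g z / C \<partial>\<nu>) = ((\<integral>z. g z \<partial>\<mu>) - (\<integral>z. g z \<partial>\<nu>)) / C"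
    by (simp add: diff_divide_distrib)
  ultimately show ?thesis
    using \<open>0 < C\<close> by (simp add: field_simps)
qed

section \<open>State-action laws\<close>

text \<open>
  The joint law of state and action when the state has the law \<open>\<pi>\<close>. All expectations below are
  integrals against such laws, so that the next-state law and the expected cost are treated alike.
\<close>
definition act_law ::
  "'u::polish_space set \<Rightarrow> ('x::polish_space \<Rightarrow> 'u measure) \<Rightarrow> 'x measure \<Rightarrow> ('x \<times> 'u) measure" where
  "act_law U \<gamma> \<pi> = \<pi> \<bind> with_action U \<gamma>"

lemma act_law_in_space:
  assumes "\<gamma> \<in> stationary_policies U" "\<pi> \<in> space (prob_algebra borel)"
  shows "act_law U \<gamma> \<pi> \<in> space (prob_algebra (sa_space U))"
  unfolding act_law_def
  using prob_space_bind'[OF assms(2) with_action_measurable[OF assms(1)]]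
    sets_bind'[OF assms(2) with_action_measurable[OF assms(1)]]
  by (simp add: space_prob_algebra)

lemma prob_algebra_saD:
  assumes "\<mu> \<in> space (prob_algebra (sa_space U))"
  shows "prob_space \<mu>" "sets \<mu> = sets (sa_space U)" "space \<mu> = UNIV \<times> U"
  using assms sets_eq_imp_space_eq[of \<mu> "sa_space U"]
  by (auto simp: space_prob_algebra space_restrict_space)

lemma space_sa_space[simp]: "space (sa_space U) = UNIV \<times> U"
  by (simp add: space_restrict_space)

lemma measurable_Pair_sa_space[measurable]:
  "(\<lambda>p. (fst p, snd p)) \<in> borel \<Otimes>\<^sub>M act_space U \<rightarrow>\<^sub>M (sa_space U :: ('x::polish_space \<times> 'u::polish_space) measure)"
proof (rule measurable_restrict_space2)
  show "(\<lambda>p. (fst p, snd p)) \<in> borel \<Otimes>\<^sub>M act_space U \<rightarrow>\<^sub>M (borel :: ('x \<times> 'u) measure)"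
    unfolding borel_prod[symmetric]
    by (intro measurable_Pair measurable_fst measurable_compose[OF measurable_snd]
              measurable_restrict_space1) simp
qed (auto simp: space_pair_measure space_restrict_space)

lemma measurable_Pair1_sa_space:
  "Pair (x :: 'x::polish_space) \<in> act_space U \<rightarrow>\<^sub>M (sa_space U :: ('x \<times> 'u::polish_space) measure)"
  using measurable_compose[OF measurable_Pair1'[of x borel "act_space U"] measurable_Pair_sa_space]
  by (simp add: comp_def)

lemma stationary_policyD:
  assumes "\<gamma> \<in> stationary_policies U"
  shows "prob_space (\<gamma> x)" "sets (\<gamma> x) = sets (act_space U)" "space (\<gamma> x) = U"
proof -
  have "\<gamma> x \<in> space (prob_algebra (act_space U))"
    using measurable_space[of \<gamma> borel "prob_algebra (act_space U)" x] assms by (simp add: stationary_policies_def)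
  then show "prob_space (\<gamma> x)" "sets (\<gamma> x) = sets (act_space U)" "space (\<gamma> x) = U"
    using sets_eq_imp_space_eq[of "\<gamma> x" "act_space U"]
    by (auto simp: space_prob_algebra space_restrict_space)
qed

lemma integral_with_action:
  fixes \<psi> :: "_ \<Rightarrow> real"
  assumes "\<gamma> \<in> stationary_policies U" "\<psi> \<in> borel_measurable (sa_space U)"
  shows "(\<integral>k. \<psi> k \<partial>with_action U \<gamma> x) = (\<integral>u. \<psi> (x, u) \<partial>\<gamma> x)"
  unfolding with_action_def
  using measurable_Pair1_sa_space[of x U] assms(2)
    measurable_cong_sets[OF stationary_policyD(2)[OF assms(1), of x] refl, of "sa_space U"]
  by (intro integral_distr) auto

lemma integral_bind_prob:
  fixes \<psi> :: "_ \<Rightarrow> real"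
  assumes M: "M \<in> space (prob_algebra L)" and N: "N \<in> L \<rightarrow>\<^sub>M prob_algebra K"
    and \<psi>: "\<psi> \<in> borel_measurable K" "\<And>k. k \<in> space K \<Longrightarrow> \<bar>\<psi> k\<bar> \<le> B"
  shows "(\<integral>k. \<psi> k \<partial>(M \<bind> N)) = (\<integral>x. (\<integral>k. \<psi> k \<partial>N x) \<partial>M)"
proof (rule integral_bind[OF \<psi>, where B'=1])
  have M': "sets M = sets L" "prob_space M" "space M = space L"
    using M sets_eq_imp_space_eq[of M L] by (auto simp: space_prob_algebra)
  show "N \<in> M \<rightarrow>\<^sub>M subprob_algebra K"
    using measurable_prob_algebraD[OF N] measurable_cong_sets[OF M'(1) refl] by blast
  show "finite_measure M" using M'(2) by (rule prob_space_imp_subprob_space[THEN subprob_space.axioms(1)])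
  show "AE x in M. emeasure (N x) (space (N x)) \<le> ennreal 1"
    using measurable_space[OF N] M'(3)
    by (auto intro!: AE_I2 simp: space_prob_algebra prob_space.emeasure_space_1)
qed

lemma integral_act_law:
  fixes \<psi> :: "_ \<Rightarrow> real"
  assumes "\<gamma> \<in> stationary_policies U" "\<pi> \<in> space (prob_algebra borel)"
    and "\<psi> \<in> borel_measurable (sa_space U)" "\<And>k. k \<in> UNIV \<times> U \<Longrightarrow> \<bar>\<psi> k\<bar> \<le> B"
  shows "(\<integral>k. \<psi> k \<partial>act_law U \<gamma> \<pi>) = (\<integral>x. (\<integral>k. \<psi> k \<partial>with_action U \<gamma> x) \<partial>\<pi>)"
  unfolding act_law_def
  using assms by (intro integral_bind_prob[OF _ with_action_measurable]) auto

lemma transition_kernelD: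
  assumes "transition_kernel U T" "k \<in> UNIV \<times> U"
  shows "prob_space (T k)" "sets (T k) = sets borel"
  using measurable_space[of T "sa_space U" "prob_algebra borel" k] assms
  by (simp_all add: transition_kernel_def space_prob_algebra)

lemma measurable_integral_transition_kernel:
  fixes f :: "'x::polish_space \<Rightarrow> real"
  assumes "transition_kernel U T" "f \<in> borel_measurable borel"
  shows "(\<lambda>k. \<integral>z. f z \<partial>T k) \<in> borel_measurable (sa_space U)"
  using assms unfolding transition_kernel_def
  by (intro measurable_compose[OF measurable_prob_algebraD integral_measurable_subprob_algebra])

lemma policy_operator_eq_bind_act_law:
  assumes "transition_kernel U T" "\<gamma> \<in> stationary_policies U" "\<pi> \<in> space (prob_algebra borel)"
  shows "policy_operator T \<gamma> \<pi> = act_law U \<gamma> \<pi> \<bind> T"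
proof -
  have T: "T \<in> sa_space U \<rightarrow>\<^sub>M subprob_algebra borel"
    using assms(1) unfolding transition_kernel_def by (rule measurable_prob_algebraD)
  have W: "with_action U \<gamma> \<in> \<pi> \<rightarrow>\<^sub>M subprob_algebra (sa_space U)"
    using measurable_prob_algebraD[OF with_action_measurable[OF assms(2)]]
      measurable_cong_sets[OF prob_algebra_borelD(2)[OF assms(3)] refl] by blast
  have "with_action U \<gamma> x \<bind> T = \<gamma> x \<bind> (\<lambda>u. T (x, u))" for x
  proof -
    interpret prob_space "\<gamma> x" by (rule stationary_policyD[OF assms(2)])
    have "Pair x \<in> \<gamma> x \<rightarrow>\<^sub>M sa_space U"
      unfolding measurable_cong_sets[OF stationary_policyD(2)[OF assms(2)] refl]
      by (rule measurable_Pair1_sa_space)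
    from bind_distr[OF this T not_empty] show ?thesis by (simp add: with_action_def comp_def)
  qed
  then show ?thesis
    unfolding policy_operator_def act_law_def
    by (subst bind_assoc[OF W T]) simp
qed

lemma policy_operator_in_space:
  assumes "transition_kernel U T" "\<gamma> \<in> stationary_policies U" "\<pi> \<in> space (prob_algebra borel)"
  shows "policy_operator T \<gamma> \<pi> \<in> space (prob_algebra borel)"
proof -
  have T: "T \<in> sa_space U \<rightarrow>\<^sub>M prob_algebra borel" using assms(1) unfolding transition_kernel_def .
  show ?thesis
    unfolding policy_operator_eq_bind_act_law[OF assms]
    using prob_space_bind'[OF act_law_in_space[OF assms(2,3)] T]
      sets_bind'[OF act_law_in_space[OF assms(2,3)] T]
    by (simp add: space_prob_algebra)
qed

lemma integral_policy_operator:
  fixes g :: "_ \<Rightarrow> real"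
  assumes "transition_kernel U T" "\<gamma> \<in> stationary_policies U" "\<pi> \<in> space (prob_algebra borel)"
    and "g \<in> borel_measurable borel" "\<And>z. \<bar>g z\<bar> \<le> B"
  shows "(\<integral>z. g z \<partial>policy_operator T \<gamma> \<pi>) = (\<integral>k. (\<integral>z. g z \<partial>T k) \<partial>act_law U \<gamma> \<pi>)"
  unfolding policy_operator_eq_bind_act_law[OF assms(1-3)]
  using assms by (intro integral_bind_prob[OF act_law_in_space, where B=B]) (auto simp: transition_kernel_def)

lemma act_law_dirac_policy:
  assumes f: "f \<in> deterministic_policies U" and \<pi>: "\<pi> \<in> space (prob_algebra borel)"
  shows "act_law U (dirac_policy U f) \<pi> = distr \<pi> (sa_space U) (\<lambda>x. (x, f x))"
proof -
  have fU: "f x \<in> U" for x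
    using f measurable_space[of f borel "act_space U" x]
    by (simp add: deterministic_policies_def space_restrict_space)
  have "with_action U (dirac_policy U f) = (\<lambda>x. return (sa_space U) (x, f x))"
    unfolding with_action_def dirac_policy_def
    using measurable_Pair1_sa_space fU by (intro ext distr_return) (auto simp: space_restrict_space)
  moreover have "(\<lambda>x. (x, f x)) \<in> \<pi> \<rightarrow>\<^sub>M sa_space U"
  proof -
    have "(\<lambda>x. (x, f x)) \<in> borel \<rightarrow>\<^sub>M borel \<Otimes>\<^sub>M act_space U"
      using f by (intro measurable_Pair) (auto simp: deterministic_policies_def)
    from measurable_compose[OF this measurable_Pair_sa_space]
    show ?thesis unfolding measurable_cong_sets[OF prob_algebra_borelD(2)[OF \<pi>] refl] by simp
  qed
  ultimately show ?thesis
    unfolding act_law_def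
    using bind_return_distr[of \<pi> "\<lambda>x. (x, f x)" "sa_space U"] prob_algebra_borelD[OF \<pi>]
    by (simp add: comp_def)
qed

section \<open>Marginals of the controlled chain\<close>

text \<open>
  The finite-dimensional laws of the trajectory measure are the iterated compositions \<open>C 0 n\<close> of
  the step kernels, so a function of the coordinate \<open>t\<close> sees only \<open>C 0 (Suc t)\<close>.
\<close>
lemma (in Ionescu_Tulcea) nn_integral_lim_component:
  assumes g: "g \<in> borel_measurable (M t)"
  shows "(\<integral>\<^sup>+ \<omega>. g (\<omega> t) \<partial>PF.lim) = (\<integral>\<^sup>+ h. g (h t) \<partial>C 0 (Suc t) (\<lambda>_. undefined))"
proof -
  let ?u = "\<lambda>_. undefined :: 'a"
  have u: "?u \<in> space (PiM {0..<0} M)" by (simp add: space_PiM)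
  have up: "up_to {t} = Suc t"
    unfolding up_to_def
    by (rule Least_equality) (auto, metis not_less_eq_eq order_refl)
  have gt: "(\<lambda>\<omega>. g (\<omega> t)) \<in> borel_measurable (PiM J M)" if "t \<in> J" for J
    by (rule measurable_compose[OF measurable_component_singleton[of t _ M] g]) (use that in auto)
  have s: "sets (C 0 (Suc t) ?u) = sets (PiM {0..<Suc t} M)"
    using sets_C[OF u, of "Suc t"] by simp
  have "(\<integral>\<^sup>+ \<omega>. g (\<omega> t) \<partial>PF.lim) = (\<integral>\<^sup>+ \<omega>. g (restrict \<omega> {t} t) \<partial>PF.lim)" by simp
  also have "\<dots> = (\<integral>\<^sup>+ \<omega>. g (\<omega> t) \<partial>distr PF.lim (PiM {t} M) (\<lambda>x. restrict x {t}))"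
    using gt[of "{t}"]
    by (intro nn_integral_distr[symmetric])
       (auto intro!: measurable_restrict_subset simp: measurable_cong_sets[OF PF.sets_lim refl]
             simp del: restrict_apply)
  also have "\<dots> = (\<integral>\<^sup>+ \<omega>. g (\<omega> t) \<partial>CI {t})" by (simp add: distr_lim)
  also have "\<dots> = (\<integral>\<^sup>+ \<omega>. g (restrict \<omega> {t} t) \<partial>C 0 (Suc t) ?u)"
    unfolding CI_def up
    using gt[of "{t}"]
    by (intro nn_integral_distr)
       (auto intro!: measurable_restrict_subset simp: measurable_cong_sets[OF s refl]
             simp del: C.simps restrict_apply)
  also have "\<dots> = (\<integral>\<^sup>+ \<omega>. g (\<omega> t) \<partial>C 0 (Suc t) ?u)" by simp
  finally show ?thesis .
qed

lemma (in Ionescu_Tulcea) nn_integral_C_last: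
  assumes g: "g \<in> borel_measurable (M t)"
  shows "(\<integral>\<^sup>+ h. g (h t) \<partial>C 0 (Suc t) (\<lambda>_. undefined)) =
         (\<integral>\<^sup>+ h. (\<integral>\<^sup>+ y. g y \<partial>P t h) \<partial>C 0 t (\<lambda>_. undefined))"
proof -
  let ?u = "\<lambda>_. undefined :: 'a"
  have s': "sets (C 0 t ?u) = sets (PiM {0..<t} M)"
    using sets_C[of ?u 0 t] by (simp add: space_PiM)
  have gt: "(\<lambda>\<omega>. g (\<omega> t)) \<in> borel_measurable (PiM {0..<Suc t} M)"
    by (rule measurable_compose[OF measurable_component_singleton[of t _ M] g]) auto
  have "(\<integral>\<^sup>+ h. g (h t) \<partial>C 0 (Suc t) ?u) = (\<integral>\<^sup>+ h. (\<integral>\<^sup>+ \<omega>. g (\<omega> t) \<partial>eP t h) \<partial>C 0 t ?u)"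
    by (simp, rule nn_integral_bind[where B="PiM {0..<Suc t} M"])
       (auto intro!: gt simp: measurable_cong_sets[OF s' refl])
  also have "\<dots> = (\<integral>\<^sup>+ h. (\<integral>\<^sup>+ y. g y \<partial>P t h) \<partial>C 0 t ?u)"
  proof (rule nn_integral_cong)
    fix h assume "h \<in> space (C 0 t ?u)"
    then have "h \<in> space (PiM {0..<t} M)" using sets_eq_imp_space_eq[OF s'] by simp
    then show "(\<integral>\<^sup>+ \<omega>. g (\<omega> t) \<partial>eP t h) = (\<integral>\<^sup>+ y. g y \<partial>P t h)"
      using gt by (subst nn_integral_eP) auto
  qed
  finally show ?thesis .
qed


text \<open>
  The chain is Markov: the step kernel depends on the past only through the last coordinate, so by
  induction the law of the pair at time \<open>t\<close> comes from iterating the policy operator \<open>t\<close> times.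
\<close>
lemma nn_integral_trajectory_law:
  assumes T: "transition_kernel U T" and \<gamma>: "\<gamma> \<in> stationary_policies U"
    and g: "g \<in> borel_measurable (sa_space U)"
  shows "(\<integral>\<^sup>+ \<omega>. g (\<omega> t) \<partial>trajectory_law U T \<gamma> x) =
         (\<integral>\<^sup>+ k. g k \<partial>act_law U \<gamma> ((policy_operator T \<gamma> ^^ t) (return borel x)))"
proof -
  interpret Ionescu_Tulcea "step_kernel U T \<gamma> x" "\<lambda>_. sa_space U"
    by (rule Ionescu_Tulcea_step_kernel[OF T \<gamma>])
  let ?u = "\<lambda>_::nat. undefined :: 'b \<times> 'a"
  let ?\<pi> = "\<lambda>t. (policy_operator T \<gamma> ^^ t) (return borel x)"
  have \<pi>: "?\<pi> t \<in> space (prob_algebra borel)" for t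
  proof (induction t)
    case 0 show ?case by (simp add: space_prob_algebra prob_space_return)
  next
    case (Suc t) then show ?case using policy_operator_in_space[OF T \<gamma>] by simp
  qed
  have W: "with_action U \<gamma> \<in> borel \<rightarrow>\<^sub>M subprob_algebra (sa_space U)"
    by (rule measurable_prob_algebraD[OF with_action_measurable[OF \<gamma>]])
  have T': "T \<in> sa_space U \<rightarrow>\<^sub>M subprob_algebra borel"
    using T unfolding transition_kernel_def by (rule measurable_prob_algebraD)
  have "(\<integral>\<^sup>+ h. (\<integral>\<^sup>+ k. g k \<partial>step_kernel U T \<gamma> x t h) \<partial>C 0 t ?u) = (\<integral>\<^sup>+ k. g k \<partial>act_law U \<gamma> (?\<pi> t))"
    if g: "g \<in> borel_measurable (sa_space U)" for g
    using g
  proof (induction t arbitrary: g)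
    case 0
    have "act_law U \<gamma> (return borel x) = with_action U \<gamma> x"
      unfolding act_law_def by (rule bind_return[OF W]) simp
    moreover have "emeasure (return (PiM {0..<0::nat} (\<lambda>_. sa_space U)) ?u)
        (space (return (PiM {0..<0::nat} (\<lambda>_. sa_space U)) ?u)) = 1"
      by (rule prob_space.emeasure_space_1[OF prob_space_return]) (simp add: space_PiM)
    ultimately show ?case
      by (simp del: space_return)
  next
    case (Suc t)
    have WT: "(\<lambda>k. T k \<bind> with_action U \<gamma>) \<in> sa_space U \<rightarrow>\<^sub>M subprob_algebra (sa_space U)"
      by (rule measurable_bind2[OF T' W])
    let ?G = "\<lambda>k. \<integral>\<^sup>+ k'. g k' \<partial>(T k \<bind> with_action U \<gamma>)"
    have G: "?G \<in> borel_measurable (sa_space U)"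
      by (rule measurable_compose[OF WT nn_integral_measurable_subprob_algebra[OF Suc.prems]])
    let ?A = "act_law U \<gamma> (?\<pi> t)"
    have A: "sets ?A = sets (sa_space U)"
      using act_law_in_space[OF \<gamma> \<pi>] by (simp add: space_prob_algebra)
    have "(\<integral>\<^sup>+ h. (\<integral>\<^sup>+ k. g k \<partial>step_kernel U T \<gamma> x (Suc t) h) \<partial>C 0 (Suc t) ?u)
        = (\<integral>\<^sup>+ h. ?G (h t) \<partial>C 0 (Suc t) ?u)" by simp
    also have "\<dots> = (\<integral>\<^sup>+ k. ?G k \<partial>?A)"
      unfolding nn_integral_C_last[OF G] by (rule Suc.IH[OF G])
    also have "\<dots> = (\<integral>\<^sup>+ k. g k \<partial>(?A \<bind> (\<lambda>k. T k \<bind> with_action U \<gamma>)))"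
      by (rule nn_integral_bind[symmetric, OF Suc.prems])
        (use WT in \<open>simp add: measurable_cong_sets[OF A refl]\<close>)
    also have "?A \<bind> (\<lambda>k. T k \<bind> with_action U \<gamma>) = (?A \<bind> T) \<bind> with_action U \<gamma>"
      by (rule bind_assoc[symmetric, OF _ W]) (use T' in \<open>simp add: measurable_cong_sets[OF A refl]\<close>)
    also have "?A \<bind> T = ?\<pi> (Suc t)"
      using policy_operator_eq_bind_act_law[OF T \<gamma> \<pi>] by simp
    finally show ?case unfolding act_law_def .
  qed
  then show ?thesis
    unfolding trajectory_law_def nn_integral_lim_component[OF g] nn_integral_C_last[OF g]
    using g by simp
qed

section \<open>Average costs of policies under a contraction\<close>

text \<open>
  The distances \<open>e\<^sub>t\<close> to \<open>\<pi>\<close> satisfy \<open>e\<^sub>t\<^sub>+\<^sub>1 \<le> \<alpha> e\<^sub>t + d\<close>: one step contracts the distance to the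
  image of \<open>\<pi>\<close>, which is within \<open>d\<close> of \<open>\<pi>\<close>.
\<close>
lemma tv_dist_iterates_le:
  fixes \<alpha> d :: real
  assumes T: "transition_kernel U T" and \<gamma>: "\<gamma> \<in> stationary_policies U"
    and \<alpha>: "0 \<le> \<alpha>" "\<alpha> < 1"
    and contr: "\<And>\<pi> \<pi>'. \<pi> \<in> space (prob_algebra borel) \<Longrightarrow> \<pi>' \<in> space (prob_algebra borel) \<Longrightarrow>
          tv_dist (policy_operator T \<gamma> \<pi>) (policy_operator T \<gamma> \<pi>') \<le> \<alpha> * tv_dist \<pi> \<pi>'"
    and \<pi>: "\<pi> \<in> space (prob_algebra borel)" "tv_dist (policy_operator T \<gamma> \<pi>) \<pi> \<le> d"
    and \<nu>: "\<nu> \<in> space (prob_algebra borel)"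
  shows "(policy_operator T \<gamma> ^^ t) \<nu> \<in> space (prob_algebra borel)"
    and "tv_dist ((policy_operator T \<gamma> ^^ t) \<nu>) \<pi> \<le> 2 * \<alpha> ^ t + d / (1 - \<alpha>)"
proof (induction t)
  case 0
  { case 1 show ?case using \<nu> by simp }
  { case 2
    have "0 \<le> d"
      using abs_integral_diff_le_tv_dist[of "policy_operator T \<gamma> \<pi>" \<pi> "\<lambda>_. 0"] \<pi>
        prob_algebra_borelD(1)[OF \<pi>(1)] prob_algebra_borelD(1)[OF policy_operator_in_space[OF T \<gamma> \<pi>(1)]]
      by simp
    then show ?case
      using tv_dist_le_2[OF prob_algebra_borelD(1)[OF \<nu>] prob_algebra_borelD(1)[OF \<pi>(1)]] \<alpha>
      by (simp add: add_increasing2) }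
next
  case (Suc t)
  let ?P = "policy_operator T \<gamma>"
  note P = policy_operator_in_space[OF T \<gamma>]
  { case 1 show ?case using P[OF Suc.IH(1)] by simp }
  { case 2
    have "tv_dist (?P ((?P ^^ t) \<nu>)) \<pi> \<le> tv_dist (?P ((?P ^^ t) \<nu>)) (?P \<pi>) + tv_dist (?P \<pi>) \<pi>"
      using prob_algebra_borelD[OF P[OF Suc.IH(1)]] prob_algebra_borelD[OF P[OF \<pi>(1)]]
        prob_algebra_borelD[OF \<pi>(1)]
      by (intro tv_dist_triangle) simp_all
    also have "\<dots> \<le> \<alpha> * (2 * \<alpha> ^ t + d / (1 - \<alpha>)) + d"
      using contr[OF Suc.IH(1) \<pi>(1)] \<pi>(2) mult_left_mono[OF Suc.IH(2) \<alpha>(1)] by linarith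
    also have "\<dots> = 2 * \<alpha> ^ Suc t + d / (1 - \<alpha>)"
      using \<alpha> by (simp add: field_simps)
    finally show ?case by simp }
qed

lemma abs_limsup_diff_le:
  fixes a b :: "nat \<Rightarrow> real"
  assumes "\<And>m. m \<ge> 1 \<Longrightarrow> \<bar>a m - A\<bar> \<le> b m + \<eta>" "b \<longlonglongrightarrow> 0"
  obtains L where "limsup (\<lambda>m. ereal (a m)) = ereal L" "\<bar>L - A\<bar> \<le> \<eta>"
proof -
  have up: "(\<lambda>m. ereal (A + \<eta> + b m)) \<longlonglongrightarrow> ereal (A + \<eta>)"
    using tendsto_add[OF tendsto_const[of "A + \<eta>"] assms(2)] by simp
  have lo: "(\<lambda>m. ereal (A - \<eta> - b m)) \<longlonglongrightarrow> ereal (A - \<eta>)"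
    using tendsto_diff[OF tendsto_const[of "A - \<eta>"] assms(2)] by simp
  have 1: "limsup (\<lambda>m. ereal (a m)) \<le> ereal (A + \<eta>)"
    unfolding lim_imp_Limsup[OF _ up, symmetric, simplified]
    by (intro Limsup_mono eventually_sequentiallyI[of 1]) (use assms(1) in \<open>force simp: abs_le_iff\<close>)
  have 2: "ereal (A - \<eta>) \<le> limsup (\<lambda>m. ereal (a m))"
    unfolding lim_imp_Limsup[OF _ lo, symmetric, simplified]
    by (intro Limsup_mono eventually_sequentiallyI[of 1]) (use assms(1) in \<open>force simp: abs_le_iff\<close>)
  show ?thesis
    using 1 2 that by (cases "limsup (\<lambda>m. ereal (a m))") (auto simp: abs_le_iff)
qed

text \<open>
  The expected cost at time \<open>t\<close> differs from the expected cost under \<open>\<pi>\<close> by at most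
  \<open>C (2 \<alpha>\<^sup>t + d / (1 - \<alpha>))\<close>. In the time average the geometric part contributes only
  \<open>O(1/m)\<close>.
\<close>
lemma avg_cost_near_act_law_integral:
  fixes c :: "'x::polish_space \<times> 'u::polish_space \<Rightarrow> real" and \<alpha> d C :: real
  assumes T: "transition_kernel U T" and \<gamma>: "\<gamma> \<in> stationary_policies U"
    and \<alpha>: "0 \<le> \<alpha>" "\<alpha> < 1"
    and contr: "\<And>\<pi> \<pi>'. \<pi> \<in> space (prob_algebra borel) \<Longrightarrow> \<pi>' \<in> space (prob_algebra borel) \<Longrightarrow>
          tv_dist (policy_operator T \<gamma> \<pi>) (policy_operator T \<gamma> \<pi>') \<le> \<alpha> * tv_dist \<pi> \<pi>'"
    and \<pi>: "\<pi> \<in> space (prob_algebra borel)" "tv_dist (policy_operator T \<gamma> \<pi>) \<pi> \<le> d"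
    and c: "c \<in> borel_measurable (sa_space U)" "\<And>k. k \<in> UNIV \<times> U \<Longrightarrow> 0 \<le> c k"
      "\<And>k. k \<in> UNIV \<times> U \<Longrightarrow> c k \<le> C" and C: "0 < C"
  obtains L where "avg_cost U T c x \<gamma> = ereal L"
    and "\<bar>L - (\<integral>k. c k \<partial>act_law U \<gamma> \<pi>)\<bar> \<le> C * d / (1 - \<alpha>)"
proof -
  let ?P = "policy_operator T \<gamma>"
  define A where "A \<nu> = (\<integral>k. c k \<partial>act_law U \<gamma> \<nu>)" for \<nu>
  define p where "p t = (?P ^^ t) (return borel x)" for t
  have p: "p t \<in> space (prob_algebra borel)" "tv_dist (p t) \<pi> \<le> 2 * \<alpha> ^ t + d / (1 - \<alpha>)" for t
    using tv_dist_iterates_le[OF T \<gamma> \<alpha> contr \<pi>, of "return borel x" t]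
    by (auto simp: p_def space_prob_algebra prob_space_return)
  have c': "\<bar>c k\<bar> \<le> C" if "k \<in> UNIV \<times> U" for k using c(2,3)[OF that] by simp
  have W: "with_action U \<gamma> x \<in> space (prob_algebra (sa_space U))" for x
    using measurable_space[OF with_action_measurable[OF \<gamma>]] by simp
  have close: "\<bar>A (p t) - A \<pi>\<bar> \<le> C * (2 * \<alpha> ^ t + d / (1 - \<alpha>))" for t
  proof -
    have m: "(\<lambda>x. \<integral>k. c k \<partial>with_action U \<gamma> x) \<in> borel_measurable (p t)"
      unfolding measurable_cong_sets[OF prob_algebra_borelD(2)[OF p(1)] refl]
      by (rule measurable_compose[OF measurable_prob_algebraD[OF with_action_measurable[OF \<gamma>]]
            integral_measurable_subprob_algebra[OF c(1)]])
    have "\<bar>\<integral>k. c k \<partial>with_action U \<gamma> x\<bar> \<le> C" for x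
      using prob_algebra_saD[OF W[of x]] c' by (intro abs_integral_le_bound) auto
    from abs_integral_diff_le_tv_dist_scaled[OF prob_algebra_borelD(1)[OF p(1)]
        prob_algebra_borelD(1)[OF \<pi>(1)] m this C]
    have "\<bar>A (p t) - A \<pi>\<bar> \<le> C * tv_dist (p t) \<pi>"
      using integral_act_law[OF \<gamma> p(1) c(1) c', of t] integral_act_law[OF \<gamma> \<pi>(1) c(1) c']
      by (simp add: A_def)
    then show ?thesis using mult_left_mono[OF p(2) less_imp_le[OF C]] by (rule order_trans)
  qed
  have nonneg: "0 \<le> A (p t)" for t
    unfolding A_def using prob_algebra_saD[OF act_law_in_space[OF \<gamma> p(1)]] c(2)
    by (intro integral_nonneg_AE AE_I2) auto
  have E: "(\<integral>\<^sup>+ \<omega>. ennreal (\<Sum>t<m. c (\<omega> t)) \<partial>trajectory_law U T \<gamma> x) = ennreal (\<Sum>t<m. A (p t))" for m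
  proof -
    interpret Ionescu_Tulcea "step_kernel U T \<gamma> x" "\<lambda>_. sa_space U"
      by (rule Ionescu_Tulcea_step_kernel[OF T \<gamma>])
    have s: "sets (trajectory_law U T \<gamma> x) = sets (PiM UNIV (\<lambda>_. sa_space U))"
      unfolding trajectory_law_def by (rule PF.sets_lim)
    have sp: "space (trajectory_law U T \<gamma> x) = UNIV \<rightarrow>\<^sub>E (UNIV \<times> U)"
      using sets_eq_imp_space_eq[OF s] by (simp add: space_PiM)
    have ct: "(\<lambda>\<omega>. ennreal (c (\<omega> t))) \<in> borel_measurable (trajectory_law U T \<gamma> x)" for t
      unfolding measurable_cong_sets[OF s refl]
      by (rule measurable_compose[OF measurable_component_singleton[of t _ "\<lambda>_. sa_space U"]])
        (use c(1) in auto)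
    have "(\<integral>\<^sup>+ \<omega>. ennreal (\<Sum>t<m. c (\<omega> t)) \<partial>trajectory_law U T \<gamma> x)
        = (\<integral>\<^sup>+ \<omega>. (\<Sum>t<m. ennreal (c (\<omega> t))) \<partial>trajectory_law U T \<gamma> x)"
      by (intro nn_integral_cong sum_ennreal[symmetric] c(2)) (auto simp: sp PiE_iff)
    also have "\<dots> = (\<Sum>t<m. \<integral>\<^sup>+ \<omega>. ennreal (c (\<omega> t)) \<partial>trajectory_law U T \<gamma> x)"
      by (rule nn_integral_sum[OF ct])
    also have "\<dots> = (\<Sum>t<m. ennreal (A (p t)))"
    proof (rule sum.cong[OF refl])
      fix t
      note Q = prob_algebra_saD[OF act_law_in_space[OF \<gamma> p(1)[of t]]]
      have "(\<integral>\<^sup>+ \<omega>. ennreal (c (\<omega> t)) \<partial>trajectory_law U T \<gamma> x) = (\<integral>\<^sup>+ k. ennreal (c k) \<partial>act_law U \<gamma> (p t))"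
        unfolding p_def using c(1) by (intro nn_integral_trajectory_law[OF T \<gamma>]) auto
      also have "\<dots> = ennreal (A (p t))"
        unfolding A_def
        using Q c c' by (intro nn_integral_eq_integral integrable_bounded_prob[where B=C] AE_I2)
          (auto simp: measurable_cong_sets[OF Q(2) refl])
      finally show "(\<integral>\<^sup>+ \<omega>. ennreal (c (\<omega> t)) \<partial>trajectory_law U T \<gamma> x) = ennreal (A (p t))" .
    qed
    also have "\<dots> = ennreal (\<Sum>t<m. A (p t))" by (rule sum_ennreal) (rule nonneg)
    finally show ?thesis .
  qed
  define S where "S m = (\<Sum>t<m. A (p t)) / real m" for m
  have "avg_cost U T c x \<gamma> = limsup (\<lambda>m. ereal (S m))"
    unfolding avg_cost_def
  proof (rule Limsup_eq, rule eventually_sequentiallyI[of 1])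
    fix m :: nat assume "1 \<le> m"
    then show "enn2ereal (\<integral>\<^sup>+ \<omega>. ennreal (\<Sum>t<m. c (\<omega> t)) \<partial>trajectory_law U T \<gamma> x) / ereal (real m) = ereal (S m)"
      unfolding E S_def by (simp add: sum_nonneg nonneg)
  qed
  moreover have "\<bar>S m - A \<pi>\<bar> \<le> (2 * C / (1 - \<alpha>)) / real m + C * d / (1 - \<alpha>)" if m: "1 \<le> m" for m
  proof -
    have geo: "(\<Sum>t<m. \<alpha> ^ t) \<le> 1 / (1 - \<alpha>)"
      using \<alpha> by (simp add: sum_gp_strict divide_right_mono)
    have "S m - A \<pi> = (\<Sum>t<m. A (p t) - A \<pi>) / real m"
      using m by (simp add: S_def sum_subtractf field_simps)
    also have "\<bar>\<dots>\<bar> \<le> (\<Sum>t<m. \<bar>A (p t) - A \<pi>\<bar>) / real m"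
      by (simp add: divide_right_mono sum_abs)
    also have "\<dots> \<le> (\<Sum>t<m. C * (2 * \<alpha> ^ t + d / (1 - \<alpha>))) / real m"
      by (intro divide_right_mono sum_mono close) simp
    also have "(\<Sum>t<m. C * (2 * \<alpha> ^ t + d / (1 - \<alpha>))) = 2 * C * (\<Sum>t<m. \<alpha> ^ t) + real m * (C * d / (1 - \<alpha>))"
      by (simp add: algebra_simps sum.distrib sum_distrib_left)
    also have "\<dots> / real m \<le> (2 * C * (1 / (1 - \<alpha>)) + real m * (C * d / (1 - \<alpha>))) / real m"
      using geo C by (intro divide_right_mono add_right_mono mult_left_mono) auto
    also have "\<dots> = (2 * C / (1 - \<alpha>)) / real m + C * d / (1 - \<alpha>)"
      using m by (simp add: add_divide_distrib)
    finally show ?thesis .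
  qed
  moreover have "(\<lambda>m. (2 * C / (1 - \<alpha>)) / real m) \<longlonglongrightarrow> 0"
    by (rule lim_const_over_n)
  ultimately show ?thesis
    using abs_limsup_diff_le[of S "A \<pi>" "\<lambda>m. (2 * C / (1 - \<alpha>)) / real m" "C * d / (1 - \<alpha>)"] that
    unfolding A_def by (metis (no_types, lifting))
qed

section \<open>Splitting atomless measures\<close>

text \<open>
  With base three, the tail after a first differing digit is at most half of that digit's value,
  so no carries can make two different \<open>0\<close>-\<open>1\<close> sequences agree.
\<close>
lemma ternary_series_first_digit:
  fixes a b :: "nat \<Rightarrow> real"
  assumes a: "\<And>n. a n \<in> {0, 1}" and b: "\<And>n. b n \<in> {0, 1}"
    and n: "\<And>m. m < n \<Longrightarrow> a m = b m" "a n = 1" "b n = 0"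
  shows "(\<Sum>m. b m * (1/3) ^ m) < (\<Sum>m. a m * (1/3) ^ m)"
proof -
  have s: "summable (\<lambda>m. (1/3 :: real) ^ m)" by (simp add: summable_geometric)
  have sb: "summable (\<lambda>m. c m * (1/3) ^ m)" if "\<And>n. c n \<in> {0, 1}" for c :: "nat \<Rightarrow> real"
  proof (rule summable_comparison_test'[OF s, of 0])
    show "norm (c n * (1/3) ^ n) \<le> (1/3) ^ n" for n using that[of n] by auto
  qed
  have split: "(\<Sum>m. c m * (1/3) ^ m) = (\<Sum>m<n. c m * (1/3) ^ m) + c n * (1/3) ^ n
      + (\<Sum>m. c (m + Suc n) * (1/3) ^ (m + Suc n))" if "\<And>n. c n \<in> {0, 1}" for c :: "nat \<Rightarrow> real"
    using suminf_split_initial_segment[of "\<lambda>m. c m * (1/3) ^ m" "Suc n", OF sb[OF that]] by simp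
  have tail_b: "(\<Sum>m. b (m + Suc n) * (1/3) ^ (m + Suc n)) \<le> (1/3) ^ n / 2"
  proof -
    have "(\<Sum>m. b (m + Suc n) * (1/3) ^ (m + Suc n)) \<le> (\<Sum>m. (1/3) ^ m * (1/3) ^ Suc n)"
    proof (rule suminf_le)
      show "b (m + Suc n) * (1/3) ^ (m + Suc n) \<le> (1/3) ^ m * (1/3) ^ Suc n" for m
        using b[of "m + Suc n"] by (auto simp: power_add)
      show "summable (\<lambda>m. b (m + Suc n) * (1/3) ^ (m + Suc n))"
        using sb[OF b] summable_ignore_initial_segment[of "\<lambda>m. b m * (1/3) ^ m" "Suc n"] by simp
      show "summable (\<lambda>m. (1/3 :: real) ^ m * (1/3) ^ Suc n)" by (rule summable_mult2[OF s])
    qed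
    also have "\<dots> = (1/3) ^ n / 2"
      using suminf_mult2[OF s, of "(1/3) ^ Suc n"] by (simp add: suminf_geometric)
    finally show ?thesis .
  qed
  have tail_a: "0 \<le> (\<Sum>m. a (m + Suc n) * (1/3) ^ (m + Suc n))"
  proof (rule suminf_nonneg)
    show "summable (\<lambda>m. a (m + Suc n) * (1/3) ^ (m + Suc n))"
      using sb[OF a] summable_ignore_initial_segment[of "\<lambda>m. a m * (1/3) ^ m" "Suc n"] by simp
    show "0 \<le> a (m + Suc n) * (1/3) ^ (m + Suc n)" for m
      using a[of "m + Suc n"] by auto
  qed
  have "(\<Sum>m<n. a m * (1/3) ^ m) = (\<Sum>m<n. b m * (1/3) ^ m)"
    using n(1) by (intro sum.cong) auto
  moreover have "(1/3 :: real) ^ n / 2 < (1/3) ^ n" by simp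
  ultimately show ?thesis
    unfolding split[OF a] split[OF b] n(2,3) using tail_a tail_b by linarith
qed

text \<open>
  A point is determined by the members of a countable basis that contain it; reading this
  \<open>0\<close>-\<open>1\<close> sequence as a ternary expansion gives a real number.
\<close>
lemma ex_borel_injection_into_real:
  "\<exists>\<iota> :: 'a::{second_countable_topology, t1_space} \<Rightarrow> real. \<iota> \<in> borel_measurable borel \<and> inj \<iota>"
proof -
  obtain B :: "'a set set" where B: "countable B" "topological_basis B"
    using ex_countable_basis by blast
  then have "B \<noteq> {}"
    by (metis UN_empty Union_empty empty_iff empty_subsetI iso_tuple_UNIV_I open_UNIV
        subset_empty topological_basis_def)
  define D where "D = from_nat_into B"
  have D: "D n \<in> B" "open (D n)" for n
    using from_nat_into[OF \<open>B \<noteq> {}\<close>] B(2) by (auto simp: D_def topological_basis_open)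
  define a where "a x n = (indicator (D n) x :: real)" for x n
  have a01: "a x n \<in> {0, 1}" for x n by (auto simp: a_def indicator_def)
  define \<iota> where "\<iota> x = (\<Sum>n. a x n * (1/3) ^ n)" for x
  have "\<iota> \<in> borel_measurable borel"
    unfolding \<iota>_def[abs_def] a_def
    using D(2) by (intro borel_measurable_suminf borel_measurable_times borel_measurable_indicator) auto
  moreover have "inj \<iota>"
  proof (rule injI, rule ccontr)
    fix x y assume eq: "\<iota> x = \<iota> y" and "x \<noteq> y"
    obtain W where "open W" "x \<in> W" "y \<notin> W" using t1_space[OF \<open>x \<noteq> y\<close>] by blast
    then obtain V where V: "V \<in> B" "x \<in> V" "V \<subseteq> W" using topological_basisE[OF B(2)] by metis
    then obtain k where "D k = V" using from_nat_into_surj[OF B(1)] by (auto simp: D_def)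
    then have "a x k \<noteq> a y k" using V \<open>y \<notin> W\<close> by (auto simp: a_def)
    define n where "n = (LEAST n. a x n \<noteq> a y n)"
    have n: "a x n \<noteq> a y n" unfolding n_def by (rule LeastI) fact
    have less: "a x m = a y m" if "m < n" for m using not_less_Least that unfolding n_def by blast
    consider "a x n = 1" "a y n = 0" | "a x n = 0" "a y n = 1" using n a01[of x n] a01[of y n] by auto
    then show False
    proof cases
      case 1
      from ternary_series_first_digit[of "a x" "a y", OF a01 a01 less this] eq show False by (simp add: \<iota>_def)
    next
      case 2
      from ternary_series_first_digit[of "a y" "a x", OF a01 a01 less[symmetric] this(2,1)] eq
      show False by (simp add: \<iota>_def)
    qed
  qed
  ultimately show ?thesis by blast
qed

text \<open>
  Along a Borel injection into the line, \<open>Q\<close> is swept out continuously: a jump of the distribution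
  function of the image measure would be an atom. The intermediate value theorem does the rest.
\<close>
lemma atomless_ex_subset_of_measure:
  fixes \<pi> :: "'a::{second_countable_topology, t1_space} measure"
  assumes "finite_measure \<pi>" "sets \<pi> = sets borel" "\<And>y. measure \<pi> {y} = 0"
    and Q: "Q \<in> sets borel" and t: "0 \<le> t" "t \<le> measure \<pi> Q"
  obtains E where "E \<in> sets borel" "E \<subseteq> Q" "measure \<pi> E = t"
proof -
  interpret finite_measure \<pi> by fact
  have sp: "space \<pi> = UNIV" using sets_eq_imp_space_eq[OF assms(2)] by simp
  obtain \<iota> :: "'a \<Rightarrow> real" where \<iota>: "\<iota> \<in> borel_measurable borel" "inj \<iota>"
    using ex_borel_injection_into_real by blast
  define \<nu> where "\<nu> = distr (restrict_space \<pi> Q) borel \<iota>"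
  have QS: "Q \<inter> space \<pi> \<in> sets \<pi>" using Q sp assms(2) by simp
  have \<iota>': "\<iota> \<in> borel_measurable (restrict_space \<pi> Q)"
    using \<iota>(1) assms(2) by (intro measurable_restrict_space1) (simp cong: measurable_cong_sets)
  have \<nu>: "measure \<nu> A = measure \<pi> (Q \<inter> \<iota> -` A)" if "A \<in> sets borel" for A
  proof -
    have "measure \<nu> A = measure (restrict_space \<pi> Q) (\<iota> -` A \<inter> Q)"
      unfolding \<nu>_def using measure_distr[OF \<iota>' that] by (simp add: space_restrict_space sp)
    also have "\<dots> = measure \<pi> (\<iota> -` A \<inter> Q)"
      by (rule measure_restrict_space[OF QS]) auto
    finally show ?thesis by (simp add: Int_commute)
  qed
  have "finite_measure (restrict_space \<pi> Q)"
    using Q assms(2) by (intro finite_measure_restrict_space[OF assms(1)]) simp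
  from finite_measure.finite_measure_distr[OF this \<iota>']
  interpret \<nu>: finite_borel_measure \<nu>
    by (intro finite_borel_measure.intro finite_borel_measure_axioms.intro) (simp_all add: \<nu>_def)
  have cont: "isCont (cdf \<nu>) r" for r
  proof -
    have "Q \<inter> \<iota> -` {r} \<subseteq> {inv \<iota> r}" using \<iota>(2) by (auto simp: inv_f_f)
    then have "measure \<pi> (Q \<inter> \<iota> -` {r}) \<le> measure \<pi> {inv \<iota> r}"
      using assms(2) by (intro finite_measure_mono) auto
    then show ?thesis unfolding \<nu>.isCont_cdf using assms(3) by (simp add: \<nu> measure_le_0_iff)
  qed
  have cdf: "cdf \<nu> r = measure \<pi> (Q \<inter> \<iota> -` {..r})" for r by (simp add: cdf_def \<nu>)
  consider "t = 0" | "t = measure \<pi> Q" | "0 < t" "t < measure \<pi> Q" using t by linarith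
  then show ?thesis
  proof cases
    case 1 then show ?thesis by (intro that[of "{}"]) auto
  next
    case 2 then show ?thesis by (intro that[of Q]) (use Q in auto)
  next
    case 3
    have "\<forall>\<^sub>F r in at_bot. cdf \<nu> r < t"
      by (rule order_tendstoD(2)[OF \<nu>.cdf_lim_at_bot 3(1)])
    then obtain r1 where r1: "\<And>r. r \<le> r1 \<Longrightarrow> cdf \<nu> r < t" unfolding eventually_at_bot_linorder by blast
    have "measure \<nu> (space \<nu>) = measure \<pi> Q" using \<nu>[of UNIV] by (simp add: \<nu>_def)
    then have "\<forall>\<^sub>F r in at_top. t < cdf \<nu> r"
      using order_tendstoD(1)[OF \<nu>.cdf_lim_at_top, of t] 3(2) by simp
    then obtain r2 where r2: "\<And>r. r \<ge> r2 \<Longrightarrow> t < cdf \<nu> r" unfolding eventually_at_top_linorder by blast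
    have "\<exists>r. r1 \<le> r \<and> r \<le> max r1 r2 \<and> cdf \<nu> r = t"
      using r1[of r1] r2[of "max r1 r2"] cont by (intro IVT) auto
    then obtain r where "cdf \<nu> r = t" by blast
    then show ?thesis
      using Q measurable_sets[OF \<iota>(1), of "{..r}"] by (intro that[of "Q \<inter> \<iota> -` {..r}"]) (auto simp: cdf)
  qed
qed

lemma atomless_ex_labelling:
  fixes \<pi> :: "'a::{second_countable_topology, t1_space} measure"
  assumes \<pi>: "finite_measure \<pi>" "sets \<pi> = sets borel" "\<And>y. measure \<pi> {y} = 0"
    and I: "finite I" "I \<noteq> {}"
    and m: "\<And>i. i \<in> I \<Longrightarrow> 0 \<le> m i"
    and Q: "Q \<in> sets borel" "(\<Sum>i\<in>I. m i) = measure \<pi> Q"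
  shows "\<exists>e \<in> borel \<rightarrow>\<^sub>M count_space I. \<forall>i\<in>I. measure \<pi> {x \<in> Q. e x = i} = m i"
  using I m Q
proof (induction I arbitrary: Q rule: finite_ne_induct)
  case (singleton i)
  have "{x \<in> Q. i = i} = Q" by simp
  with singleton show ?case by (intro bexI[of _ "\<lambda>_. i"]) auto
next
  case (insert i I)
  interpret finite_measure \<pi> by fact
  have "0 \<le> m i" "m i \<le> measure \<pi> Q"
    using insert.prems insert.hyps by (auto simp flip: insert.prems(3) simp: sum_nonneg)
  then obtain E where E: "E \<in> sets borel" "E \<subseteq> Q" "measure \<pi> E = m i"
    using atomless_ex_subset_of_measure[OF \<pi> insert.prems(2)] by blast
  have sum: "(\<Sum>i\<in>I. m i) = measure \<pi> (Q - E)"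
    using E insert.prems insert.hyps \<pi>(2) by (subst finite_measure_Diff) auto
  obtain e
    where e: "e \<in> borel \<rightarrow>\<^sub>M count_space I" "\<forall>j\<in>I. measure \<pi> {x \<in> Q - E. e x = j} = m j"
    using bexE[OF insert.IH[of "Q - E", OF insert.prems(1) sets.Diff[OF insert.prems(2) E(1)] sum]]
    by blast
  define e' where "e' x = (if x \<in> E then i else e x)" for x
  have eI: "e x \<in> I" for x using measurable_space[OF e(1), of x] by simp
  have "e \<in> borel \<rightarrow>\<^sub>M count_space (insert i I)"
    using measurable_compose[OF e(1), of "\<lambda>x. x" "count_space (insert i I)"] by auto
  then have "e' \<in> borel \<rightarrow>\<^sub>M count_space (insert i I)"
    unfolding e'_def[abs_def] using E(1) by (intro measurable_If_set) auto
  moreover have "measure \<pi> {x \<in> Q. e' x = j} = m j" if "j \<in> insert i I" for j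
  proof (cases "j = i")
    case True
    then have "{x \<in> Q. e' x = j} = E" using E(2) eI \<open>i \<notin> I\<close> by (auto simp: e'_def)
    with True E(3) show ?thesis by simp
  next
    case False
    then have "{x \<in> Q. e' x = j} = {x \<in> Q - E. e x = j}" by (auto simp: e'_def)
    with False that e(2) show ?thesis by simp
  qed
  ultimately show ?case by blast
qed

text \<open>
  Mixing the values \<open>h j i x\<close> over \<open>i\<close> with the weights \<open>w i x\<close> can be imitated by choosing a single
  label \<open>e x\<close>, for all \<open>j\<close> simultaneously. The cells are the level sets of the vector of roundings of
  all \<open>h j i\<close> to multiples of \<open>\<delta>\<close>; on a cell the rounded functions are constant, and there the
  labels are chosen with exactly the right masses, so that only rounding errors remain.
\<close>
lemma atomless_purification:
  fixes \<pi> :: "'a::{second_countable_topology, t1_space} measure"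
    and h :: "'j \<Rightarrow> 'i \<Rightarrow> 'a \<Rightarrow> real" and w :: "'i \<Rightarrow> 'a \<Rightarrow> real"
  assumes \<pi>: "prob_space \<pi>" "sets \<pi> = sets borel" "\<And>y. measure \<pi> {y} = 0"
    and I: "finite I" "I \<noteq> {}" and J: "finite J"
    and w: "\<And>i. i \<in> I \<Longrightarrow> w i \<in> borel_measurable borel" "\<And>i x. i \<in> I \<Longrightarrow> 0 \<le> w i x"
      "\<And>x. (\<Sum>i\<in>I. w i x) = 1"
    and h: "\<And>j i. j \<in> J \<Longrightarrow> i \<in> I \<Longrightarrow> h j i \<in> borel_measurable borel"
      "\<And>j i x. j \<in> J \<Longrightarrow> i \<in> I \<Longrightarrow> \<bar>h j i x\<bar> \<le> B"
    and \<epsilon>: "0 < \<epsilon>"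
  shows "\<exists>e \<in> borel \<rightarrow>\<^sub>M count_space I. \<forall>j\<in>J.
     \<bar>(\<integral>x. h j (e x) x \<partial>\<pi>) - (\<integral>x. (\<Sum>i\<in>I. w i x * h j i x) \<partial>\<pi>)\<bar> \<le> \<epsilon>"
proof -
  interpret prob_space \<pi> by fact
  have sp: "space \<pi> = UNIV" using sets_eq_imp_space_eq[OF \<pi>(2)] by simp
  have meas: "g \<in> borel_measurable \<pi> \<longleftrightarrow> g \<in> borel_measurable borel" for g :: "'a \<Rightarrow> real"
    by (simp add: measurable_cong_sets[OF \<pi>(2) refl])
  define \<delta> where "\<delta> = \<epsilon> / 2"
  have \<delta>: "0 < \<delta>" using \<epsilon> by (simp add: \<delta>_def)
  \<comment> \<open>\<open>r x\<close> names the cell of \<open>x\<close>; boundedness of \<open>h\<close> leaves finitely many cells.\<close>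
  define r where "r x = (\<lambda>p\<in>J \<times> I. \<lfloor>h (fst p) (snd p) x / \<delta>\<rfloor>)" for x
  define R where "R = (J \<times> I) \<rightarrow>\<^sub>E {\<lfloor>- B / \<delta>\<rfloor>..\<lfloor>B / \<delta>\<rfloor>}"
  have R: "finite R" unfolding R_def using I J by (intro finite_PiE) auto
  have rR: "r x \<in> R" for x
  proof -
    have "\<lfloor>h j i x / \<delta>\<rfloor> \<in> {\<lfloor>- B / \<delta>\<rfloor>..\<lfloor>B / \<delta>\<rfloor>}" if "j \<in> J" "i \<in> I" for j i
      using h(2)[OF that, of x] \<delta> by (auto simp: abs_le_iff intro!: floor_mono simp: field_simps)
    then show ?thesis unfolding r_def R_def by auto
  qed
  define Q where "Q l = {x. r x = l}" for l
  have Q: "Q l \<in> sets borel" if "l \<in> R" for l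
  proof -
    have "Q l = {x \<in> space borel. \<forall>p\<in>J \<times> I. \<lfloor>h (fst p) (snd p) x / \<delta>\<rfloor> = l p}"
      using that unfolding Q_def r_def R_def by (auto simp: fun_eq_iff restrict_def PiE_iff extensional_def)
    moreover have "\<dots> \<in> sets borel"
    proof (intro sets.sets_Collect_finite_All)
      fix p assume "p \<in> J \<times> I"
      then have [measurable]: "h (fst p) (snd p) \<in> borel_measurable borel" using h(1) by auto
      show "{x \<in> space borel. \<lfloor>h (fst p) (snd p) x / \<delta>\<rfloor> = l p} \<in> sets borel" by measurable
    qed (use I J in auto)
    ultimately show ?thesis by simp
  qed
  define m where "m l i = (\<integral>x. indicator (Q l) x * w i x \<partial>\<pi>)" for l i
  have w1: "w i x \<le> 1" if "i \<in> I" for i x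
    using member_le_sum[of i I "\<lambda>i. w i x"] that w I by auto
  have iw: "integrable \<pi> (\<lambda>x. indicator (Q l) x * w i x)" if "l \<in> R" "i \<in> I" for l i
    using w(1)[OF that(2)] w(2)[OF that(2)] w1[OF that(2)] Q[OF that(1)]
    by (intro integrable_bounded_prob[OF \<pi>(1), where B=1])
       (auto simp: meas indicator_def intro!: borel_measurable_times)
  have "\<exists>e \<in> borel \<rightarrow>\<^sub>M count_space I. \<forall>i\<in>I. measure \<pi> {x \<in> Q l. e x = i} = m l i" if l: "l \<in> R" for l
  proof (rule atomless_ex_labelling[OF finite_measure_axioms \<pi>(2,3) I _ Q[OF l]])
    show "0 \<le> m l i" if "i \<in> I" for i
      unfolding m_def using w(2)[OF that] by (intro integral_nonneg_AE AE_I2) auto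
    have "(\<Sum>i\<in>I. m l i) = (\<integral>x. (\<Sum>i\<in>I. indicator (Q l) x * w i x) \<partial>\<pi>)"
      unfolding m_def using iw[OF l] by (intro Bochner_Integration.integral_sum[symmetric]) auto
    also have "\<dots> = (\<integral>x. indicator (Q l) x \<partial>\<pi>)" by (simp flip: sum_distrib_left add: w(3))
    finally show "(\<Sum>i\<in>I. m l i) = measure \<pi> (Q l)" using Q[OF l] \<pi>(2) by simp
  qed
  then obtain E where E: "\<And>l. l \<in> R \<Longrightarrow> E l \<in> borel \<rightarrow>\<^sub>M count_space I"
      "\<And>l i. l \<in> R \<Longrightarrow> i \<in> I \<Longrightarrow> measure \<pi> {x \<in> Q l. E l x = i} = m l i"
    by metis
  define e where "e x = E (r x) x" for x
  have eI: "e x \<in> I" for x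
    using measurable_space[OF E(1)[OF rR[of x]], of x] by (simp add: e_def)
  have lev: "{x. e x = i} = (\<Union>l\<in>R. {x \<in> Q l. E l x = i})" for i
    using rR by (auto simp: e_def Q_def)
  have lev': "{x \<in> Q l. E l x = i} \<in> sets borel" if "l \<in> R" "i \<in> I" for l i
  proof -
    have "{x \<in> Q l. E l x = i} = Q l \<inter> (E l -` {i} \<inter> space borel)" by auto
    then show ?thesis using Q[OF that(1)] measurable_sets[OF E(1)[OF that(1)], of "{i}"] that by auto
  qed
  have lev_sets: "{x. e x = i} \<in> sets borel" if "i \<in> I" for i
    unfolding lev using R lev' that by auto
  have e: "e \<in> borel \<rightarrow>\<^sub>M count_space I"
  proof (rule measurable_count_space_eq2[OF I(1), THEN iffD2], intro conjI ballI)
    fix i assume "i \<in> I"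
    have "e -` {i} \<inter> space borel = {x. e x = i}" by auto
    then show "e -` {i} \<inter> space borel \<in> sets borel" using lev_sets[OF \<open>i \<in> I\<close>] by simp
  qed (use eI in auto)
  have "\<bar>(\<integral>x. h j (e x) x \<partial>\<pi>) - (\<integral>x. (\<Sum>i\<in>I. w i x * h j i x) \<partial>\<pi>)\<bar> \<le> \<epsilon>" if j: "j \<in> J" for j
  proof -
    let ?s = "\<lambda>i x. indicator {x. e x = i} x - w i x"
    define h' where "h' i x = \<delta> * real_of_int \<lfloor>h j i x / \<delta>\<rfloor>" for i x
    have hh': "\<bar>h j i x - h' i x\<bar> \<le> \<delta>" for i x
    proof -
      have "h j i x - h' i x = \<delta> * (h j i x / \<delta> - of_int \<lfloor>h j i x / \<delta>\<rfloor>)"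
        using \<delta> by (simp add: h'_def field_simps)
      moreover have "\<bar>h j i x / \<delta> - of_int \<lfloor>h j i x / \<delta>\<rfloor>\<bar> \<le> 1"
        by (simp add: abs_le_iff) linarith
      ultimately show ?thesis using \<delta> by (simp add: abs_mult)
    qed
    have sm[measurable]: "?s i \<in> borel_measurable borel" if "i \<in> I" for i
      using lev_sets[OF that] w(1)[OF that] by (intro borel_measurable_diff borel_measurable_indicator) auto
    have sb: "\<bar>?s i x\<bar> \<le> 1" if "i \<in> I" for i x
      using w(2)[OF that, of x] w1[OF that, of x] by (auto simp: indicator_def)
    have hm[measurable]: "h j i \<in> borel_measurable borel" if "i \<in> I" for i using h(1)[OF j that] .
    have ih: "integrable \<pi> (\<lambda>x. ?s i x * h j i x)" if "i \<in> I" for i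
    proof (rule integrable_bounded_prob[OF \<pi>(1), where B=B])
      show "\<bar>?s i x * h j i x\<bar> \<le> B" for x
        using mult_mono[OF sb[OF that, of x] h(2)[OF j that, of x]] by (simp add: abs_mult)
    qed (use sm[OF that] hm[OF that] in \<open>auto simp: meas\<close>)
    have h'm: "h' i \<in> borel_measurable borel" if "i \<in> I" for i
      unfolding h'_def using hm[OF that] by measurable
    have h'b: "\<bar>h' i x\<bar> \<le> B + \<delta>" if "i \<in> I" for i x
      using hh'[of i x] h(2)[OF j that, of x] by linarith
    have ih': "integrable \<pi> (\<lambda>x. ?s i x * h' i x)" if "i \<in> I" for i
    proof (rule integrable_bounded_prob[OF \<pi>(1), where B="B + \<delta>"])
      show "\<bar>?s i x * h' i x\<bar> \<le> B + \<delta>" for x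
        using mult_mono[OF sb[OF that, of x] h'b[OF that, of x]] by (simp add: abs_mult)
    qed (use sm[OF that] h'm[OF that] in \<open>auto simp: meas\<close>)
    have ilev: "integrable \<pi> (indicat_real {x \<in> Q l. E l x = i})" if "l \<in> R" "i \<in> I" for l i
      using lev'[OF that] \<pi>(2) by (intro integrable_real_indicator) (auto simp: emeasure_eq_measure)
    \<comment> \<open>On each cell \<open>h' i\<close> is constant and \<open>{e = i}\<close> has the mass prescribed by \<open>w i\<close>.\<close>
    have zero: "(\<integral>x. ?s i x * h' i x \<partial>\<pi>) = 0" if i: "i \<in> I" for i
    proof -
      have "?s i x * h' i x = (\<Sum>l\<in>R. \<delta> * l (j, i) * (indicator {x \<in> Q l. E l x = i} x - indicator (Q l) x * w i x))"
        for x
      proof -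
        have "(\<Sum>l\<in>R. \<delta> * l (j, i) * (indicator {x \<in> Q l. E l x = i} x - indicator (Q l) x * w i x))
            = (\<Sum>l\<in>{r x}. \<delta> * l (j, i) * (indicator {x \<in> Q l. E l x = i} x - indicator (Q l) x * w i x))"
          using R rR[of x] by (intro sum.mono_neutral_right) (auto simp: Q_def)
        also have "\<dots> = h' i x * ?s i x"
          using i j by (auto simp: h'_def r_def Q_def e_def indicator_def)
        finally show ?thesis by simp
      qed
      then have "(\<integral>x. ?s i x * h' i x \<partial>\<pi>) = (\<integral>x. (\<Sum>l\<in>R. \<delta> * l (j, i) * (indicator {x \<in> Q l. E l x = i} x - indicator (Q l) x * w i x)) \<partial>\<pi>)"
        by simp
      also have "\<dots> = (\<Sum>l\<in>R. \<delta> * l (j, i) * (\<integral>x. indicator {x \<in> Q l. E l x = i} x - indicator (Q l) x * w i x \<partial>\<pi>))"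
        using iw[OF _ i] ilev[OF _ i]
        by (subst Bochner_Integration.integral_sum) (auto intro!: integrable_mult_right Bochner_Integration.integrable_diff)
      also have "\<dots> = (\<Sum>l\<in>R. \<delta> * l (j, i) * (measure \<pi> {x \<in> Q l. E l x = i} - m l i))"
        using iw[OF _ i] ilev[OF _ i] lev'[OF _ i] \<pi>(2)
        by (intro sum.cong refl, subst Bochner_Integration.integral_diff) (auto simp: m_def)
      also have "\<dots> = 0" using E(2) i by simp
      finally show ?thesis .
    qed
    have hs: "h j (e x) x = (\<Sum>i\<in>I. indicator {x. e x = i} x * h j i x)" for x
      using eI[of x] I(1) by (simp add: indicator_def if_distrib[of "\<lambda>y. y * _"] sum.delta cong: if_cong)
    have i1: "integrable \<pi> (\<lambda>x. \<Sum>i\<in>I. indicator {x. e x = i} x * h j i x)"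
    proof (intro Bochner_Integration.integrable_sum integrable_bounded_prob[OF \<pi>(1), where B=B])
      fix i x assume "i \<in> I"
      then show "\<bar>indicator {x. e x = i} x * h j i x\<bar> \<le> B"
        using h(2)[OF j, of i x] by (auto simp: indicator_def intro: order_trans[OF abs_ge_zero])
    next
      fix i assume "i \<in> I"
      then show "(\<lambda>x. indicator {x. e x = i} x * h j i x) \<in> borel_measurable \<pi>"
        unfolding meas using hm lev_sets by (intro borel_measurable_times borel_measurable_indicator) auto
    qed
    have i2: "integrable \<pi> (\<lambda>x. \<Sum>i\<in>I. w i x * h j i x)"
    proof (intro Bochner_Integration.integrable_sum integrable_bounded_prob[OF \<pi>(1), where B=B])
      fix i x assume "i \<in> I"
      then show "\<bar>w i x * h j i x\<bar> \<le> B"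
        using mult_mono[OF w1[of i x] h(2)[OF j, of i x]] w(2)[of i x] by (simp add: abs_mult)
    qed (use w(1) hm in \<open>auto simp: meas\<close>)
    have "(\<integral>x. h j (e x) x \<partial>\<pi>) - (\<integral>x. (\<Sum>i\<in>I. w i x * h j i x) \<partial>\<pi>) = (\<integral>x. (\<Sum>i\<in>I. ?s i x * h j i x) \<partial>\<pi>)"
      unfolding hs Bochner_Integration.integral_diff[OF i1 i2, symmetric]
      by (simp add: sum_subtractf left_diff_distrib)
    also have "\<dots> = (\<integral>x. (\<Sum>i\<in>I. ?s i x * h j i x) \<partial>\<pi>) - (\<Sum>i\<in>I. \<integral>x. ?s i x * h' i x \<partial>\<pi>)"
      using zero by simp
    also have "\<dots> = (\<integral>x. (\<Sum>i\<in>I. ?s i x * h j i x) - (\<Sum>i\<in>I. ?s i x * h' i x) \<partial>\<pi>)"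
      using ih ih' by simp
    also have "\<bar>\<dots>\<bar> \<le> 2 * \<delta>"
    proof (rule abs_integral_le_bound[OF \<pi>(1)])
      fix x
      have "\<bar>(\<Sum>i\<in>I. ?s i x * h j i x) - (\<Sum>i\<in>I. ?s i x * h' i x)\<bar> = \<bar>\<Sum>i\<in>I. ?s i x * (h j i x - h' i x)\<bar>"
        by (simp add: sum_subtractf right_diff_distrib)
      also have "\<dots> \<le> (\<Sum>i\<in>I. (indicator {x. e x = i} x + w i x) * \<delta>)"
      proof (rule order_trans[OF sum_abs], rule sum_mono)
        fix i assume "i \<in> I"
        then have "\<bar>?s i x\<bar> \<le> indicator {x. e x = i} x + w i x" using w(2)[of i x] by (auto simp: indicator_def)
        then show "\<bar>?s i x * (h j i x - h' i x)\<bar> \<le> (indicator {x. e x = i} x + w i x) * \<delta>"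
          unfolding abs_mult using hh' by (intro mult_mono) auto
      qed
      also have "\<dots> = 2 * \<delta>"
        using eI[of x] I(1) by (simp add: sum.distrib w(3) indicator_def algebra_simps flip: sum_distrib_left sum_distrib_right)
      finally show "\<bar>(\<Sum>i\<in>I. ?s i x * h j i x) - (\<Sum>i\<in>I. ?s i x * h' i x)\<bar> \<le> 2 * \<delta>" .
    qed
    finally show ?thesis by (simp add: \<delta>_def)
  qed
  with e show ?thesis by blast
qed


section \<open>Approximating a randomized policy by a deterministic one\<close>

text \<open>
  The recursion updates the best index so far, an earlier index winning ties, so that measurability
  follows by induction on \<open>n\<close>.
\<close>
primrec nearest_index :: "(nat \<Rightarrow> 'a::metric_space) \<Rightarrow> nat \<Rightarrow> 'a \<Rightarrow> nat" where
  "nearest_index d 0 u = 0"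
| "nearest_index d (Suc n) u =
     (if dist u (d (Suc n)) < dist u (d (nearest_index d n u)) then Suc n else nearest_index d n u)"

lemma nearest_index_le: "nearest_index d n u \<le> n"
  by (induction n) auto

lemma dist_nearest_index_le:
  "j \<le> n \<Longrightarrow> dist u (d (nearest_index d n u)) \<le> dist u (d j)"
  by (induction n) (auto simp: le_Suc_eq)

lemma measurable_nearest_index[measurable]:
  fixes d :: "nat \<Rightarrow> 'a::{metric_space, second_countable_topology}"
  shows "nearest_index d n \<in> borel \<rightarrow>\<^sub>M count_space UNIV"
proof (induction n)
  case (Suc n)
  note [measurable] = Suc
  have [measurable]: "d \<in> count_space UNIV \<rightarrow>\<^sub>M borel" by simp
  have "(\<lambda>u. if dist u (d (Suc n)) < dist u (d (nearest_index d n u)) then Suc n else nearest_index d n u)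
      \<in> borel \<rightarrow>\<^sub>M count_space UNIV"
    by measurable
  then show ?case by (simp add: fun_eq_iff cong: measurable_cong)
qed (simp cong: measurable_cong)

lemma nearest_index_tendsto:
  assumes "u \<in> closure (range d)"
  shows "(\<lambda>n. d (nearest_index d n u)) \<longlonglongrightarrow> u"
proof (rule metric_LIMSEQ_I)
  fix r :: real assume "0 < r"
  then obtain j where "dist (d j) u < r" using assms by (auto simp: closure_approachable)
  then show "\<exists>no. \<forall>n\<ge>no. dist (d (nearest_index d n u)) u < r"
    using dist_nearest_index_le[of j _ u d] by (intro exI[of _ j]) (auto simp: dist_commute intro: le_less_trans)
qed

text \<open>
  Sending each action to its nearest neighbour among finitely many points of a dense sequence changes
  the finitely many integrals arbitrarily little, by continuity in the action and dominated
  convergence under the joint law. The resulting randomization over finitely many actions is then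
  purified.
\<close>
lemma deterministic_approximation:
  fixes U :: "'u::polish_space set" and \<pi> :: "'x::polish_space measure"
    and \<psi> :: "'j \<Rightarrow> 'x \<times> 'u \<Rightarrow> real"
  assumes \<gamma>: "\<gamma> \<in> stationary_policies U"
    and \<pi>: "\<pi> \<in> space (prob_algebra borel)" "\<And>y. measure \<pi> {y} = 0"
    and J: "finite J"
    and \<psi>: "\<And>j. j \<in> J \<Longrightarrow> \<psi> j \<in> borel_measurable (sa_space U)"
      "\<And>j k. j \<in> J \<Longrightarrow> k \<in> UNIV \<times> U \<Longrightarrow> \<bar>\<psi> j k\<bar> \<le> B"
      "\<And>j x. j \<in> J \<Longrightarrow> continuous_on U (\<lambda>u. \<psi> j (x, u))"
    and \<epsilon>: "0 < \<epsilon>"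
  shows "\<exists>f \<in> deterministic_policies U. finite (range f) \<and>
    (\<forall>j\<in>J. \<bar>(\<integral>k. \<psi> j k \<partial>act_law U (dirac_policy U f) \<pi>) - (\<integral>k. \<psi> j k \<partial>act_law U \<gamma> \<pi>)\<bar> \<le> \<epsilon>)"
proof -
  let ?A = "act_law U \<gamma> \<pi>"
  note A = prob_algebra_saD[OF act_law_in_space[OF \<gamma> \<pi>(1)]]
  note \<pi>' = prob_algebra_borelD[OF \<pi>(1)]
  interpret A: prob_space ?A by (rule A)
  have U: "U \<noteq> {}"
    using prob_space.not_empty[OF stationary_policyD(1)[OF \<gamma>]] stationary_policyD(3)[OF \<gamma>] by auto
  obtain D where D: "countable D" "D \<subseteq> U" "U \<subseteq> closure D" by (rule separable[of U])
  have "D \<noteq> {}" using D(3) U by auto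
  define d where "d = from_nat_into D"
  have range_d: "range d = D" unfolding d_def using D(1) \<open>D \<noteq> {}\<close> by (rule range_from_nat_into[rotated])
  have dU: "d i \<in> U" for i using range_d D(2) by auto
  define q where "q n k = (fst k, d (nearest_index d n (snd k)))" for n and k :: "'x \<times> 'u"
  have q: "q n \<in> sa_space U \<rightarrow>\<^sub>M sa_space U" for n
  proof (rule measurable_restrict_space2)
    have [measurable]: "d \<in> count_space UNIV \<rightarrow>\<^sub>M borel" by simp
    have "q n \<in> borel \<rightarrow>\<^sub>M borel"
      unfolding q_def[abs_def] borel_prod[symmetric] by measurable
    then show "q n \<in> sa_space U \<rightarrow>\<^sub>M borel" by (rule measurable_restrict_space1)
  qed (use dU in \<open>auto simp: q_def\<close>)
  have qU: "q n k \<in> UNIV \<times> U" for n k using dU by (simp add: q_def)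
  have lim: "(\<lambda>n. \<integral>k. \<psi> j (q n k) \<partial>?A) \<longlonglongrightarrow> (\<integral>k. \<psi> j k \<partial>?A)" if j: "j \<in> J" for j
  proof (rule integral_dominated_convergence[where w="\<lambda>_. B"])
    show "\<psi> j \<in> borel_measurable ?A" "(\<lambda>k. \<psi> j (q n k)) \<in> borel_measurable ?A" for n
      unfolding measurable_cong_sets[OF A(2) refl]
      using \<psi>(1)[OF j] measurable_compose[OF q \<psi>(1)[OF j]] by auto
    show "AE k in ?A. (\<lambda>n. \<psi> j (q n k)) \<longlonglongrightarrow> \<psi> j k"
    proof (rule AE_I2)
      fix k assume "k \<in> space ?A"
      then obtain x u where k: "k = (x, u)" "u \<in> U" using A(3) by auto
      have "(\<lambda>n. d (nearest_index d n u)) \<longlonglongrightarrow> u"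
        using k(2) D(3) range_d by (intro nearest_index_tendsto) auto
      from continuous_on_tendsto_compose[OF \<psi>(3)[OF j, of x] this k(2)] dU
      show "(\<lambda>n. \<psi> j (q n k)) \<longlonglongrightarrow> \<psi> j k" by (simp add: q_def k)
    qed
    show "AE k in ?A. norm (\<psi> j (q n k)) \<le> B" for n
      using \<psi>(2)[OF j qU] by (intro AE_I2) auto
  qed simp
  have "\<forall>\<^sub>F n in sequentially. \<forall>j\<in>J. \<bar>(\<integral>k. \<psi> j (q n k) \<partial>?A) - (\<integral>k. \<psi> j k \<partial>?A)\<bar> < \<epsilon> / 2"
    using J
  proof (rule eventually_ball_finite, intro ballI)
    fix j assume "j \<in> J"
    from tendstoD[OF lim[OF this], of "\<epsilon> / 2"] \<epsilon>
    show "\<forall>\<^sub>F n in sequentially. \<bar>(\<integral>k. \<psi> j (q n k) \<partial>?A) - (\<integral>k. \<psi> j k \<partial>?A)\<bar> < \<epsilon> / 2"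
      by (simp add: dist_real_def)
  qed
  then obtain n where n: "\<And>j. j \<in> J \<Longrightarrow> \<bar>(\<integral>k. \<psi> j (q n k) \<partial>?A) - (\<integral>k. \<psi> j k \<partial>?A)\<bar> < \<epsilon> / 2"
    unfolding eventually_sequentially by blast
  define w where "w i x = measure (\<gamma> x) {u \<in> U. nearest_index d n u = i}" for i x
  have lev: "{u \<in> U. nearest_index d n u = i} \<in> sets (act_space U)" for i
  proof -
    have "nearest_index d n -` {i} \<inter> space borel \<in> sets borel"
      by (rule measurable_sets[OF measurable_nearest_index]) simp
    then have "U \<inter> (nearest_index d n -` {i}) \<in> sets (act_space U)"
      by (auto simp: sets_restrict_space)
    moreover have "U \<inter> (nearest_index d n -` {i}) = {u \<in> U. nearest_index d n u = i}" by auto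
    ultimately show ?thesis by simp
  qed
  have w: "w i \<in> borel_measurable borel" "0 \<le> w i x" for i x
    unfolding w_def
    using measurable_compose[OF measurable_prob_algebraD[OF \<gamma>[unfolded stationary_policies_def]]
        measurable_measure_subprob_algebra[OF lev]] by auto
  have int\<gamma>: "(\<integral>u. g (nearest_index d n u) \<partial>\<gamma> x) = (\<Sum>i\<le>n. w i x * g i)" for g :: "nat \<Rightarrow> real" and x
  proof -
    interpret G: prob_space "\<gamma> x" by (rule stationary_policyD[OF \<gamma>])
    note G = stationary_policyD[OF \<gamma>, of x]
    have "(\<integral>u. g (nearest_index d n u) \<partial>\<gamma> x)
        = (\<integral>u. (\<Sum>i\<le>n. indicator {u \<in> U. nearest_index d n u = i} u * g i) \<partial>\<gamma> x)"
    proof (rule Bochner_Integration.integral_cong[OF refl])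
      fix u assume "u \<in> space (\<gamma> x)"
      then show "g (nearest_index d n u) = (\<Sum>i\<le>n. indicator {u \<in> U. nearest_index d n u = i} u * g i)"
        using nearest_index_le[of d n u] G(3)
        by (simp add: indicator_def if_distrib[of "\<lambda>y. y * _"] sum.delta cong: if_cong)
    qed
    also have "\<dots> = (\<Sum>i\<le>n. w i x * g i)"
      using lev G(2) by (subst Bochner_Integration.integral_sum)
        (auto simp: w_def G.emeasure_eq_measure intro!: integrable_mult_left integrable_real_indicator)
    finally show ?thesis .
  qed
  have w1: "(\<Sum>i\<le>n. w i x) = 1" for x
    using int\<gamma>[of x "\<lambda>_. 1"] prob_space.prob_space[OF stationary_policyD(1)[OF \<gamma>, of x]] by simp
  define h where "h j i x = \<psi> j (x, d i)" for j i x
  have h: "h j i \<in> borel_measurable borel" "\<bar>h j i x\<bar> \<le> B" if "j \<in> J" for j i x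
  proof -
    have "(\<lambda>x. (x, d i)) \<in> borel \<rightarrow>\<^sub>M sa_space U"
      using dU by (intro measurable_restrict_space2) (auto simp: borel_prod[symmetric])
    from measurable_compose[OF this \<psi>(1)[OF that]] show "h j i \<in> borel_measurable borel"
      by (simp add: h_def[abs_def])
    show "\<bar>h j i x\<bar> \<le> B" unfolding h_def using \<psi>(2)[OF that] dU by simp
  qed
  have rand: "(\<integral>k. \<psi> j (q n k) \<partial>?A) = (\<integral>x. (\<Sum>i\<le>n. w i x * h j i x) \<partial>\<pi>)" if j: "j \<in> J" for j
  proof -
    have m: "(\<lambda>k. \<psi> j (q n k)) \<in> borel_measurable (sa_space U)" by (rule measurable_compose[OF q \<psi>(1)[OF j]])
    have "(\<integral>k. \<psi> j (q n k) \<partial>?A) = (\<integral>x. (\<integral>k. \<psi> j (q n k) \<partial>with_action U \<gamma> x) \<partial>\<pi>)"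
      by (rule integral_act_law[OF \<gamma> \<pi>(1) m \<psi>(2)[OF j qU]])
    also have "\<dots> = (\<integral>x. (\<Sum>i\<le>n. w i x * h j i x) \<partial>\<pi>)"
    proof (rule Bochner_Integration.integral_cong[OF refl])
      fix x
      show "(\<integral>k. \<psi> j (q n k) \<partial>with_action U \<gamma> x) = (\<Sum>i\<le>n. w i x * h j i x)"
        unfolding integral_with_action[OF \<gamma> m] using int\<gamma>[of x "\<lambda>i. \<psi> j (x, d i)"]
        by (simp add: q_def h_def)
    qed
    finally show ?thesis .
  qed
  obtain e where e: "e \<in> borel \<rightarrow>\<^sub>M count_space {..n}"
    "\<And>j. j \<in> J \<Longrightarrow> \<bar>(\<integral>x. h j (e x) x \<partial>\<pi>) - (\<integral>x. (\<Sum>i\<le>n. w i x * h j i x) \<partial>\<pi>)\<bar> \<le> \<epsilon> / 2"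
  proof -
    have "\<exists>e \<in> borel \<rightarrow>\<^sub>M count_space {..n}. \<forall>j\<in>J.
        \<bar>(\<integral>x. h j (e x) x \<partial>\<pi>) - (\<integral>x. (\<Sum>i\<le>n. w i x * h j i x) \<partial>\<pi>)\<bar> \<le> \<epsilon> / 2"
      using w w1 h \<epsilon> J by (intro atomless_purification[OF \<pi>'(1,2) \<pi>(2), where B=B]) auto
    then show ?thesis using that by blast
  qed
  define f where "f x = d (e x)" for x
  have f: "f \<in> deterministic_policies U"
    unfolding deterministic_policies_def f_def[abs_def]
    by (rule measurable_compose[OF e(1)]) (use dU in \<open>auto simp: space_restrict_space\<close>)
  have "finite (range f)"
  proof (rule finite_subset)
    show "range f \<subseteq> d ` {..n}" using measurable_space[OF e(1)] by (auto simp: f_def)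
  qed simp
  moreover have "(\<integral>k. \<psi> j k \<partial>act_law U (dirac_policy U f) \<pi>) = (\<integral>x. h j (e x) x \<partial>\<pi>)" if j: "j \<in> J" for j
  proof -
    have "(\<lambda>x. (x, f x)) \<in> borel \<rightarrow>\<^sub>M borel \<Otimes>\<^sub>M act_space U"
      using f by (intro measurable_Pair) (auto simp: deterministic_policies_def)
    from measurable_compose[OF this measurable_Pair_sa_space]
    have "(\<lambda>x. (x, f x)) \<in> \<pi> \<rightarrow>\<^sub>M sa_space U"
      unfolding measurable_cong_sets[OF \<pi>'(2) refl] by simp
    from integral_distr[OF this \<psi>(1)[OF j]] show ?thesis
      unfolding act_law_dirac_policy[OF f \<pi>(1)] by (simp add: f_def h_def)
  qed
  ultimately show ?thesis
    using f e(2) n rand by (intro bexI[of _ f]) (auto, smt (verit) field_sum_of_halves)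
qed

section \<open>Total variation of mixtures of equicontinuous densities\<close>

lemma equicontinuous_family_continuous:
  assumes "equicontinuous_family I F" "i \<in> I"
  shows "continuous_on UNIV (F i)"
  unfolding continuous_on_iff
proof (intro ballI allI impI)
  fix y and e :: real assume "0 < e"
  then obtain \<delta> where "0 < \<delta>" "\<And>y'. dist y' y < \<delta> \<Longrightarrow> \<bar>F i y' - F i y\<bar> < e"
    using assms unfolding equicontinuous_family_def by meson
  then show "\<exists>d>0. \<forall>x'\<in>UNIV. dist x' y < d \<longrightarrow> dist (F i x') (F i y) < e"
    by (auto simp: dist_real_def)
qed

text \<open>
  Markov's inequality. Together with continuity of the densities it makes the reference measure
  locally finite where some density is positive.
\<close>
lemma emeasure_density_superlevel_le:
  assumes f: "f \<in> borel_measurable M" "prob_space (density M (\<lambda>y. ennreal (f y)))"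
  shows "emeasure M {y \<in> space M. 1 / real (Suc n) < f y} \<le> ennreal (real (Suc n))"
proof -
  let ?W = "{y \<in> space M. 1 / real (Suc n) < f y}"
  have W: "?W \<in> sets M" using f(1) by measurable
  have "emeasure M ?W = (\<integral>\<^sup>+y. indicator ?W y \<partial>M)" using W by simp
  also have "\<dots> \<le> (\<integral>\<^sup>+y. ennreal (real (Suc n)) * ennreal (f y) \<partial>M)"
  proof (rule nn_integral_mono)
    fix y
    have "1 \<le> real (Suc n) * f y" if "1 / real (Suc n) < f y"
      using that by (simp add: field_simps)
    then show "indicator ?W y \<le> ennreal (real (Suc n)) * ennreal (f y)"
      by (auto simp: indicator_def ennreal_mult'[symmetric] simp del: of_nat_Suc)
  qed
  also have "\<dots> = ennreal (real (Suc n)) * (\<integral>\<^sup>+y. ennreal (f y) \<partial>M)"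
    using f(1) by (intro nn_integral_cmult) auto
  also have "(\<integral>\<^sup>+y. ennreal (f y) \<partial>M) = 1"
    using prob_space.emeasure_space_1[OF f(2)] f(1) emeasure_density[of "\<lambda>y. ennreal (f y)" M "space M"]
    by (simp add: nn_integral_cong[of M "\<lambda>x. ennreal (f x) * indicator (space M) x" "\<lambda>x. ennreal (f x)"])
  finally show ?thesis by simp
qed

text \<open>
  The functions \<open>g y\<close> form a partition of unity on a compact set, subordinate to balls so small that
  every density is constant there up to \<open>\<tau>\<close>, whatever its index \<open>k\<close>. On such a ball, integrating
  \<open>h * g y\<close> against a constant density amounts to integrating a multiple of \<open>g y\<close>, the factor
  \<open>\<theta> y\<close> being the \<open>\<phi>\<close>-average of \<open>h\<close> with weight \<open>g y\<close>. The factor does not depend on \<open>k\<close>, hence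
  the estimate survives any mixing over \<open>k\<close>.
\<close>
lemma equicontinuous_densities_test_functions:
  fixes dens :: "'i \<Rightarrow> 'x::polish_space \<Rightarrow> real" and p :: "'x measure"
  assumes \<phi>: "sets \<phi> = sets borel"
    and densities: "\<forall>k\<in>I. dens k \<in> borel_measurable borel \<and> (\<forall>y. 0 \<le> dens k y) \<and>
      prob_space (density \<phi> (\<lambda>y. ennreal (dens k y)))"
    and equi: "equicontinuous_family I dens"
    and p: "p \<in> space (prob_algebra borel)" "measure p {y. \<forall>k\<in>I. dens k y = 0} = 0"
    and \<eta>: "0 < \<eta>"
  shows "\<exists>(F :: 'x set) (g :: 'x \<Rightarrow> 'x \<Rightarrow> real).
    finite F \<and> (\<forall>y\<in>F. continuous_on UNIV (g y)) \<and> (\<forall>y z. 0 \<le> g y z) \<and>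
    (\<forall>z. (\<Sum>y\<in>F. g y z) \<le> 1) \<and> (\<integral>z. 1 - (\<Sum>y\<in>F. g y z) \<partial>p) \<le> \<eta> \<and>
    (\<forall>h. h \<in> borel_measurable borel \<longrightarrow> (\<forall>z. \<bar>h z\<bar> \<le> 1) \<longrightarrow> (\<exists>\<theta>. (\<forall>y. \<bar>\<theta> y\<bar> \<le> 1) \<and>
       (\<forall>k\<in>I. \<bar>(\<integral>z. h z * (\<Sum>y\<in>F. g y z) \<partial>density \<phi> (\<lambda>y. ennreal (dens k y))) -
          (\<Sum>y\<in>F. \<theta> y * (\<integral>z. g y z \<partial>density \<phi> (\<lambda>y. ennreal (dens k y))))\<bar> \<le> \<eta>)))"
proof -
  have dens: "dens k \<in> borel_measurable borel" "0 \<le> dens k y"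
    and prob: "prob_space (density \<phi> (\<lambda>y. ennreal (dens k y)))" if "k \<in> I" for k y
    using densities that by auto
  note p' = prob_algebra_borelD[OF p(1)]
  interpret p: prob_space p by (rule p')
  have sp: "space \<phi> = UNIV" using sets_eq_imp_space_eq[OF \<phi>] by simp
  have cont: "continuous_on UNIV (dens k)" if "k \<in> I" for k
    by (rule equicontinuous_family_continuous[OF equi that])
  define W where "W kn = {y. 1 / real (Suc (snd kn)) < dens (fst kn) y}" for kn :: "'i \<times> nat"
  have W: "open (W kn)" if "kn \<in> I \<times> UNIV" for kn
    unfolding W_def using cont that by (intro open_Collect_less continuous_on_const) auto
  have W_fin: "emeasure \<phi> (W kn) < \<infinity>" if "kn \<in> I \<times> UNIV" for kn
  proof -
    have "dens (fst kn) \<in> borel_measurable \<phi>"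
      using dens(1) that by (auto simp: measurable_cong_sets[OF \<phi> refl])
    from emeasure_density_superlevel_le[OF this prob, of "snd kn"] that
    show ?thesis by (auto simp: W_def sp intro: le_less_trans)
  qed
  define P where "P = (\<Union>kn\<in>I \<times> UNIV. W kn)"
  have "open P" unfolding P_def using W by blast
  \<comment> \<open>Every density vanishes off \<open>P\<close>, so \<open>P\<close> carries all of \<open>p\<close>.\<close>
  have "- P \<subseteq> {y. \<forall>k\<in>I. dens k y = 0}"
  proof (intro subsetI CollectI ballI)
    fix y k assume "y \<in> - P" "k \<in> I"
    then have "dens k y \<le> 1 / real (Suc n)" for n
      unfolding P_def W_def by (force simp: not_less)
    then have "dens k y \<le> 0"
      by (intro LIMSEQ_le_const[OF LIMSEQ_inverse_real_of_nat]) (auto simp: inverse_eq_divide)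
    then show "dens k y = 0" using dens(2)[OF \<open>k \<in> I\<close>, of y] by simp
  qed
  moreover have "{y. \<forall>k\<in>I. dens k y = 0} \<in> sets p"
  proof -
    have "closed (\<Inter>k\<in>I. {y. dens k y = 0})"
      using cont by (intro closed_INT ballI closed_Collect_eq continuous_on_const) auto
    moreover have "(\<Inter>k\<in>I. {y. dens k y = 0}) = {y. \<forall>k\<in>I. dens k y = 0}" by auto
    ultimately have "closed {y. \<forall>k\<in>I. dens k y = 0}" by simp
    then show ?thesis using p'(2) by simp
  qed
  ultimately have "measure p (- P) \<le> measure p {y. \<forall>k\<in>I. dens k y = 0}"
    by (rule p.finite_measure_mono)
  then have "measure p (- P) \<le> 0" using p(2) by simp
  then have "1 \<le> measure p P"
    using p.prob_compl[of P] \<open>open P\<close> p'(2,3) by (simp add: Compl_eq_Diff_UNIV)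
  then have pP: "measure p P = 1" by (rule antisym[OF p.prob_le_1])
  obtain C where C: "compact C" "C \<subseteq> P" "1 - \<eta> < measure p C"
  proof -
    have "emeasure p P = (SUP K \<in> {K. K \<subseteq> P \<and> compact K}. emeasure p K)"
      by (rule inner_regular[OF p'(2)]) (use \<open>open P\<close> p.emeasure_finite in auto)
    moreover have "ennreal (1 - \<eta>) < emeasure p P"
      using pP \<eta> by (simp add: p.emeasure_eq_measure ennreal_less_one_iff)
    ultimately obtain K where "K \<subseteq> P" "compact K" "ennreal (1 - \<eta>) < emeasure p K"
      by (auto simp: less_SUP_iff)
    moreover from this(3) have "1 - \<eta> < measure p K"
      unfolding p.emeasure_eq_measure by (metis ennreal_leI not_le)
    ultimately show ?thesis using that by blast
  qed
  obtain S where S: "S \<subseteq> I \<times> UNIV" "finite S" "C \<subseteq> (\<Union>kn\<in>S. W kn)"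
    using compactE_image[OF C(1), of "I \<times> UNIV" W] W C(2) unfolding P_def by metis
  define V where "V = (\<Union>kn\<in>S. W kn)"
  have "open V" unfolding V_def using S(1) W by (intro open_UN) blast
  with S(3) have V: "open V" "C \<subseteq> V" by (auto simp: V_def)
  have V_sets: "V \<in> sets \<phi>" using V(1) \<phi> by simp
  have V_fin: "emeasure \<phi> V < \<infinity>"
  proof -
    have "emeasure \<phi> V \<le> (\<Sum>kn\<in>S. emeasure \<phi> (W kn))"
      unfolding V_def using S W \<phi> by (intro emeasure_subadditive_finite) auto
    also have "\<dots> < \<infinity>" using S W_fin by (auto simp: less_top)
    finally show ?thesis .
  qed
  \<comment> \<open>The oscillation \<open>\<tau>\<close> must be small against the \<open>\<phi>\<close>-mass of the union of all the balls. Hence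
    the open set \<open>V\<close> of finite mass is fixed before the balls, which are chosen inside it.\<close>
  define v where "v = measure \<phi> V"
  have v: "0 \<le> v" by (simp add: v_def)
  define \<tau> where "\<tau> = \<eta> / (2 * (v + 1))"
  have \<tau>: "0 < \<tau>" "2 * \<tau> * v \<le> \<eta>"
    using \<eta> v by (auto simp: \<tau>_def field_simps)
  have "\<exists>r>0. ball y r \<subseteq> V \<and> (\<forall>z\<in>ball y r. \<forall>k\<in>I. \<bar>dens k z - dens k y\<bar> \<le> \<tau>)" if y: "y \<in> C" for y
  proof -
    obtain r1 where r1: "r1 > 0" "ball y r1 \<subseteq> V"
      using V y by (meson openE subsetD)
    obtain r2 where r2: "r2 > 0" "\<forall>z. dist z y < r2 \<longrightarrow> (\<forall>k\<in>I. \<bar>dens k z - dens k y\<bar> < \<tau>)"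
      using equi \<tau>(1) unfolding equicontinuous_family_def by meson
    show ?thesis
      using r1 r2 by (intro exI[of _ "min r1 r2"]) (auto simp: dist_commute less_imp_le subset_iff)
  qed
  then obtain r where r: "\<And>y. y \<in> C \<Longrightarrow> 0 < r y" "\<And>y. y \<in> C \<Longrightarrow> ball y (r y) \<subseteq> V"
    "\<And>y z k. y \<in> C \<Longrightarrow> z \<in> ball y (r y) \<Longrightarrow> k \<in> I \<Longrightarrow> \<bar>dens k z - dens k y\<bar> \<le> \<tau>"
    by metis
  obtain F where F: "F \<subseteq> C" "finite F" "C \<subseteq> (\<Union>y\<in>F. ball y (r y))"
    by (rule compactE_image[OF C(1), of C "\<lambda>y. ball y (r y)"]) (use r(1) in force)+
  define b where "b y z = max 0 (r y - dist z y)" for y z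
  define s where "s z = (\<Sum>y\<in>F. b y z)" for z
  have b_cont: "continuous_on A (b y)" for A y unfolding b_def by (intro continuous_intros)
  have s_cont: "continuous_on A s" for A unfolding s_def by (intro continuous_intros b_cont)
  have b_nonneg: "0 \<le> b y z" for y z by (simp add: b_def)
  have b_le: "b y z \<le> s z" if "y \<in> F" for y z
    unfolding s_def using F(2) b_nonneg that by (intro member_le_sum) auto
  have s_pos: "0 < s z" if "z \<in> C" for z
  proof -
    from that F(3) obtain y where "y \<in> F" "z \<in> ball y (r y)" by blast
    then show ?thesis using b_le[of y z] by (auto simp: b_def dist_commute)
  qed
  obtain \<sigma> where \<sigma>: "0 < \<sigma>" "\<And>z. z \<in> C \<Longrightarrow> \<sigma> \<le> s z"
  proof (cases "C = {}")
    case True then show ?thesis using that[of 1] by auto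
  next
    case False
    from continuous_attains_inf[OF C(1) False s_cont]
    obtain z where "z \<in> C" "\<forall>z'\<in>C. s z \<le> s z'" by blast
    then show ?thesis using that[of "s z"] s_pos by auto
  qed
  \<comment> \<open>Dividing by \<open>s\<close> alone would fail where \<open>s\<close> vanishes; on \<open>C\<close> the cut-off \<open>\<sigma>\<close> is inactive.\<close>
  define g where "g y z = b y z / max (s z) \<sigma>" for y z
  have mx: "0 < max (s z) \<sigma>" for z using \<sigma>(1) by simp
  have g_cont: "continuous_on UNIV (g y)" for y
    unfolding g_def using mx by (intro continuous_intros b_cont s_cont) (metis less_irrefl)
  have g_meas[measurable]: "g y \<in> borel_measurable borel" for y
    using g_cont by (rule borel_measurable_continuous_onI)
  have g_nonneg: "0 \<le> g y z" for y z
    unfolding g_def using b_nonneg mx[of z] by simp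
  have sum_g: "(\<Sum>y\<in>F. g y z) = s z / max (s z) \<sigma>" for z
    unfolding g_def s_def by (simp add: sum_divide_distrib)
  have sum_g_le: "(\<Sum>y\<in>F. g y z) \<le> 1" for z
    unfolding sum_g using mx[of z] by (simp add: divide_le_eq)
  have sum_g_nonneg: "0 \<le> (\<Sum>y\<in>F. g y z)" for z by (intro sum_nonneg g_nonneg)
  have sum_g_C: "(\<Sum>y\<in>F. g y z) = 1" if "z \<in> C" for z
    unfolding sum_g using \<sigma>(2)[OF that] s_pos[OF that] by simp
  have g_le1: "g y z \<le> 1" if "y \<in> F" for y z
    using member_le_sum[of y F "\<lambda>y. g y z"] that g_nonneg F(2) sum_g_le[of z] by auto
  have g_supp: "g y z = 0" if "z \<notin> ball y (r y)" for y z
    using that by (simp add: g_def b_def dist_commute)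
  have g_ind: "g y z \<le> indicator V z" if "y \<in> F" for y z
  proof (cases "z \<in> V")
    case False
    have "y \<in> C" using F(1) that by blast
    from r(2)[OF this] False have "z \<notin> ball y (r y)" by blast
    then show ?thesis using g_supp by simp
  qed (use g_le1[OF that] in simp)
  have iV: "integrable \<phi> (indicat_real V)" using V_sets V_fin by (intro integrable_real_indicator)
  have m\<phi>: "f \<in> borel_measurable \<phi> \<longleftrightarrow> f \<in> borel_measurable borel" for f :: "'x \<Rightarrow> real"
    by (simp add: measurable_cong_sets[OF \<phi> refl])
  have ig: "integrable \<phi> (\<lambda>z. f z * g y z)"
    if "y \<in> F" "f \<in> borel_measurable borel" "\<And>z. \<bar>f z\<bar> \<le> B" for f y B
  proof (rule Bochner_Integration.integrable_bound[of \<phi> "\<lambda>z. B * indicator V z"])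
    show "AE z in \<phi>. norm (f z * g y z) \<le> norm (B * indicator V z)"
    proof (rule AE_I2)
      fix z
      have "\<bar>f z\<bar> * g y z \<le> B * indicator V z"
        using that(3)[of z] g_nonneg g_ind[OF that(1), of z] by (intro mult_mono) auto
      also have "\<dots> \<le> \<bar>B * indicator V z\<bar>" by simp
      finally show "norm (f z * g y z) \<le> norm (B * indicator V z)" using g_nonneg by (simp add: abs_mult)
    qed
  qed (use that(2) iV in \<open>auto simp: m\<phi>\<close>)
  have ig1: "integrable \<phi> (g y)" if "y \<in> F" for y using ig[OF that, of "\<lambda>_. 1" 1] by simp
  show ?thesis
  proof (intro exI[of _ F] exI[of _ g] conjI[OF F(2)] conjI allI ballI impI g_cont g_nonneg sum_g_le)
    have iC: "integrable p (indicat_real C)"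
      using compact_imp_closed[OF C(1)] p'(2)
      by (intro integrable_real_indicator) (auto simp: p.emeasure_eq_measure)
    have "(\<integral>z. 1 - (\<Sum>y\<in>F. g y z) \<partial>p) \<le> (\<integral>z. 1 - indicator C z \<partial>p)"
    proof (rule integral_mono)
      show "integrable p (\<lambda>z. 1 - (\<Sum>y\<in>F. g y z))"
        using sum_g_le sum_g_nonneg
        by (intro integrable_bounded_prob[OF p'(1), where B=1])
          (auto simp: measurable_cong_sets[OF p'(2) refl] abs_le_iff)
      show "integrable p (\<lambda>z. 1 - indicator C z :: real)" using iC by simp
      show "1 - (\<Sum>y\<in>F. g y z) \<le> 1 - indicator C z" for z
        using sum_g_C[of z] sum_g_nonneg[of z] by (auto simp: indicator_def)
    qed
    also have "\<dots> = 1 - measure p C"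
      using iC compact_imp_closed[OF C(1)] p'(2) by (simp add: p.prob_space)
    finally show "(\<integral>z. 1 - (\<Sum>y\<in>F. g y z) \<partial>p) \<le> \<eta>" using C(3) by simp
  next
    fix h :: "'x \<Rightarrow> real" assume h: "h \<in> borel_measurable borel" and "\<forall>z. \<bar>h z\<bar> \<le> 1"
    then have h: "h \<in> borel_measurable borel" "\<And>z. \<bar>h z\<bar> \<le> 1" by auto
    \<comment> \<open>If \<open>g y\<close> is \<open>\<phi>\<close>-null, both integrals vanish and the quotient is \<open>0\<close>, which is a correct
      choice too.\<close>
    define \<theta> where "\<theta> y = (if y \<in> F then (\<integral>z. h z * g y z \<partial>\<phi>) / (\<integral>z. g y z \<partial>\<phi>) else 0)" for y
    have hg: "\<bar>\<integral>z. h z * g y z \<partial>\<phi>\<bar> \<le> (\<integral>z. g y z \<partial>\<phi>)" if "y \<in> F" for y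
    proof (rule abs_integral_le_integral)
      show "\<bar>h z * g y z\<bar> \<le> g y z" for z
        using mult_right_mono[OF h(2)[of z] g_nonneg[of y z]] g_nonneg by (simp add: abs_mult)
    qed (use ig[OF that h] ig1[OF that] in auto)
    have \<theta>1: "\<bar>\<theta> y\<bar> \<le> 1" for y
      using hg[of y] by (auto simp: \<theta>_def divide_le_eq_1 abs_divide)
    have \<theta>0: "(\<integral>z. (h z - \<theta> y) * g y z \<partial>\<phi>) = 0" if "y \<in> F" for y
    proof -
      have "(\<integral>z. (h z - \<theta> y) * g y z \<partial>\<phi>) = (\<integral>z. h z * g y z \<partial>\<phi>) - \<theta> y * (\<integral>z. g y z \<partial>\<phi>)"
        using ig[OF that h] ig1[OF that] by (simp add: left_diff_distrib)
      also have "\<dots> = 0" using hg[OF that] that by (auto simp: \<theta>_def)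
      finally show ?thesis .
    qed
    have "\<bar>(\<integral>z. h z * (\<Sum>y\<in>F. g y z) \<partial>density \<phi> (\<lambda>y. ennreal (dens k y))) -
          (\<Sum>y\<in>F. \<theta> y * (\<integral>z. g y z \<partial>density \<phi> (\<lambda>y. ennreal (dens k y))))\<bar> \<le> \<eta>" if k: "k \<in> I" for k
    proof -
      let ?T = "density \<phi> (\<lambda>y. ennreal (dens k y))"
      have mT: "f \<in> borel_measurable ?T \<longleftrightarrow> f \<in> borel_measurable borel" for f :: "'x \<Rightarrow> real"
        by (simp add: m\<phi>)
      have iT: "integrable ?T f" if "f \<in> borel_measurable borel" "\<And>z. \<bar>f z\<bar> \<le> B" for f :: "'x \<Rightarrow> real" and B
        using that by (intro integrable_bounded_prob[OF prob[OF k], where B=B]) (auto simp: m\<phi>)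
      have piece: "\<bar>\<integral>z. (h z - \<theta> y) * g y z \<partial>?T\<bar> \<le> 2 * \<tau> * (\<integral>z. g y z \<partial>\<phi>)" if y: "y \<in> F" for y
      proof -
        have yC: "y \<in> C" using y F(1) by auto
        have h\<theta>: "\<bar>h z - \<theta> y\<bar> \<le> 2" for z using h(2)[of z] \<theta>1[of y] by linarith
        have m: "(\<lambda>z. (h z - \<theta> y) * g y z) \<in> borel_measurable borel" using h(1) by measurable
        have i0: "integrable \<phi> (\<lambda>z. (h z - \<theta> y) * g y z)" using h(1) h\<theta> by (intro ig[OF y]) auto
        have bd: "\<bar>(h z - \<theta> y) * g y z\<bar> \<le> 2" for z
          using mult_mono[OF h\<theta>[of z] g_le1[OF y, of z]] g_nonneg[of y z] by (simp add: abs_mult)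
        have i1: "integrable \<phi> (\<lambda>z. dens k z * ((h z - \<theta> y) * g y z))"
          using iT[OF m bd] dens(2)[OF k] dens(1)[OF k] m
          by (subst (asm) integrable_real_density) (auto simp: m\<phi>)
        have "(\<integral>z. (h z - \<theta> y) * g y z \<partial>?T) = (\<integral>z. dens k z * ((h z - \<theta> y) * g y z) \<partial>\<phi>)"
          using dens(2)[OF k] dens(1)[OF k] m by (intro integral_real_density) (auto simp: m\<phi>)
        also have "\<dots> = (\<integral>z. dens k z * ((h z - \<theta> y) * g y z) \<partial>\<phi>) - dens k y * (\<integral>z. (h z - \<theta> y) * g y z \<partial>\<phi>)"
          using \<theta>0[OF y] by simp
        also have "\<dots> = (\<integral>z. dens k z * ((h z - \<theta> y) * g y z) - dens k y * ((h z - \<theta> y) * g y z) \<partial>\<phi>)"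
          using i0 i1 by simp
        also have "\<bar>\<dots>\<bar> \<le> (\<integral>z. 2 * \<tau> * g y z \<partial>\<phi>)"
        proof (rule abs_integral_le_integral)
          fix z
          show "\<bar>dens k z * ((h z - \<theta> y) * g y z) - dens k y * ((h z - \<theta> y) * g y z)\<bar> \<le> 2 * \<tau> * g y z"
          proof (cases "z \<in> ball y (r y)")
            case True
            have "\<bar>dens k z * ((h z - \<theta> y) * g y z) - dens k y * ((h z - \<theta> y) * g y z)\<bar>
                = \<bar>dens k z - dens k y\<bar> * \<bar>h z - \<theta> y\<bar> * g y z"
              using g_nonneg[of y z] by (simp add: abs_mult flip: left_diff_distrib)
            also have "\<dots> \<le> \<tau> * 2 * g y z"
              using r(3)[OF yC True k] h\<theta>[of z] g_nonneg[of y z] \<tau>(1) by (intro mult_mono) auto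
            finally show ?thesis by (simp add: mult.commute)
          qed (simp add: g_supp)
        qed (use i0 i1 ig1[OF y] in auto)
        finally show ?thesis by simp
      qed
      have "(\<integral>z. h z * (\<Sum>y\<in>F. g y z) \<partial>?T) - (\<Sum>y\<in>F. \<theta> y * (\<integral>z. g y z \<partial>?T))
          = (\<Sum>y\<in>F. \<integral>z. (h z - \<theta> y) * g y z \<partial>?T)"
      proof -
        have gb: "\<bar>g y z\<bar> \<le> 1" if "y \<in> F" for y z using g_le1[OF that, of z] g_nonneg[of y z] by simp
        have hgb: "\<bar>h z * g y z\<bar> \<le> 1" if "y \<in> F" for y z
          using mult_mono[OF h(2)[of z] gb[OF that, of z]] by (simp add: abs_mult)
        have ihg: "integrable ?T (\<lambda>z. h z * g y z)" "integrable ?T (g y)" if "y \<in> F" for y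
          using h(1) hgb[OF that] gb[OF that] by (auto intro!: iT[of _ 1])
        have "(\<integral>z. h z * (\<Sum>y\<in>F. g y z) \<partial>?T) = (\<Sum>y\<in>F. \<integral>z. h z * g y z \<partial>?T)"
          unfolding sum_distrib_left using ihg by (intro Bochner_Integration.integral_sum) auto
        moreover have "(\<integral>z. (h z - \<theta> y) * g y z \<partial>?T) = (\<integral>z. h z * g y z \<partial>?T) - \<theta> y * (\<integral>z. g y z \<partial>?T)"
          if "y \<in> F" for y
          using ihg[OF that] by (simp add: left_diff_distrib)
        ultimately show ?thesis by (simp add: sum_subtractf)
      qed
      also have "\<bar>\<dots>\<bar> \<le> (\<Sum>y\<in>F. 2 * \<tau> * (\<integral>z. g y z \<partial>\<phi>))"
        by (rule order_trans[OF sum_abs]) (intro sum_mono piece)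
      also have "\<dots> = 2 * \<tau> * (\<integral>z. (\<Sum>y\<in>F. g y z) \<partial>\<phi>)"
        using ig1 by (simp add: sum_distrib_left)
      also have "\<dots> \<le> 2 * \<tau> * v"
      proof (intro mult_left_mono)
        have "(\<integral>z. (\<Sum>y\<in>F. g y z) \<partial>\<phi>) \<le> (\<integral>z. indicator V z \<partial>\<phi>)"
        proof (rule integral_mono)
          fix z
          show "(\<Sum>y\<in>F. g y z) \<le> indicator V z"
          proof (cases "z \<in> V")
            case False
            then have "g y z = 0" if "y \<in> F" for y using g_ind[OF that, of z] g_nonneg[of y z] by simp
            then show ?thesis by simp
          qed (use sum_g_le in simp)
        qed (use ig1 iV in auto)
        also have "\<dots> = v" using V_sets by (simp add: v_def)
        finally show "(\<integral>z. (\<Sum>y\<in>F. g y z) \<partial>\<phi>) \<le> v" .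
      qed (use \<tau> in simp)
      also have "\<dots> \<le> \<eta>" by (rule \<tau>)
      finally show ?thesis .
    qed
    with \<theta>1 show "\<exists>\<theta>. (\<forall>y. \<bar>\<theta> y\<bar> \<le> 1) \<and>
       (\<forall>k\<in>I. \<bar>(\<integral>z. h z * (\<Sum>y\<in>F. g y z) \<partial>density \<phi> (\<lambda>y. ennreal (dens k y))) -
          (\<Sum>y\<in>F. \<theta> y * (\<integral>z. g y z \<partial>density \<phi> (\<lambda>y. ennreal (dens k y))))\<bar> \<le> \<eta>)"
      by blast
  qed
qed

section \<open>Deterministic policies are dense in cost\<close>

lemma measure_policy_operator_eq_0:
  assumes "transition_kernel U T" "\<gamma> \<in> stationary_policies U" "\<pi> \<in> space (prob_algebra borel)"
    and Z: "Z \<in> sets borel" "\<And>k. k \<in> UNIV \<times> U \<Longrightarrow> measure (T k) Z = 0"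
  shows "measure (policy_operator T \<gamma> \<pi>) Z = 0"
proof -
  note A = prob_algebra_saD[OF act_law_in_space[OF assms(2,3)]]
  note P = prob_algebra_borelD[OF policy_operator_in_space[OF assms(1-3)]]
  note T = transition_kernelD(2)[OF assms(1)]
  have "measure (policy_operator T \<gamma> \<pi>) Z = (\<integral>z. indicator Z z \<partial>policy_operator T \<gamma> \<pi>)"
    using Z(1) P by simp
  also have "\<dots> = (\<integral>k. (\<integral>z. indicator Z z \<partial>T k) \<partial>act_law U \<gamma> \<pi>)"
    using Z(1) by (intro integral_policy_operator[OF assms(1-3), where B=1]) auto
  also have "\<dots> = (\<integral>k. 0 \<partial>act_law U \<gamma> \<pi>)"
  proof (rule Bochner_Integration.integral_cong[OF refl])
    fix k assume "k \<in> space (act_law U \<gamma> \<pi>)"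
    then have k: "k \<in> UNIV \<times> U" using A(3) by simp
    then show "(\<integral>z. indicator Z z \<partial>T k) = (0::real)"
      using Z T[OF k] sets_eq_imp_space_eq[OF T[OF k]] by simp
  qed
  finally show ?thesis by simp
qed

text \<open>
  The total variation bound is uniform in \<open>h\<close>, although \<open>\<theta>\<close> varies with \<open>h\<close>, because \<open>\<theta>\<close> is
  bounded by \<open>1\<close>. The mass that the bumps miss under \<open>\<gamma>'\<close> is one minus the sum of the integrals of
  the \<open>g y\<close>, and these are close to the integrals under \<open>\<gamma>\<close>; so it is small as well.
\<close>
lemma tv_dist_policy_operator_le:
  fixes g :: "'x::polish_space \<Rightarrow> 'x \<Rightarrow> real" and U :: "'u::polish_space set"
  assumes T: "transition_kernel U T"
    and \<gamma>: "\<gamma> \<in> stationary_policies U" and \<gamma>': "\<gamma>' \<in> stationary_policies U"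
    and \<pi>: "\<pi> \<in> space (prob_algebra borel)"
    and g: "finite F" "\<And>y. y \<in> F \<Longrightarrow> g y \<in> borel_measurable borel" "\<And>y z. 0 \<le> g y z"
      "\<And>z. (\<Sum>y\<in>F. g y z) \<le> 1"
    and tail: "(\<integral>z. 1 - (\<Sum>y\<in>F. g y z) \<partial>policy_operator T \<gamma> \<pi>) \<le> \<eta>"
    and test: "\<And>h. h \<in> borel_measurable borel \<Longrightarrow> (\<And>z. \<bar>h z\<bar> \<le> 1) \<Longrightarrow> \<exists>\<theta>. (\<forall>y. \<bar>\<theta> y\<bar> \<le> 1) \<and>
       (\<forall>k\<in>UNIV \<times> U. \<bar>(\<integral>z. h z * (\<Sum>y\<in>F. g y z) \<partial>T k) - (\<Sum>y\<in>F. \<theta> y * (\<integral>z. g y z \<partial>T k))\<bar> \<le> \<eta>)"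
    and close: "(\<Sum>y\<in>F. \<bar>(\<integral>k. (\<integral>z. g y z \<partial>T k) \<partial>act_law U \<gamma>' \<pi>) - (\<integral>k. (\<integral>z. g y z \<partial>T k) \<partial>act_law U \<gamma> \<pi>)\<bar>) \<le> \<eta>"
  shows "tv_dist (policy_operator T \<gamma>' \<pi>) (policy_operator T \<gamma> \<pi>) \<le> 6 * \<eta>"
proof (rule tv_dist_le)
  let ?q = "\<lambda>\<gamma>. policy_operator T \<gamma> \<pi>"
  let ?A = "\<lambda>\<gamma>. act_law U \<gamma> \<pi>"
  let ?G = "\<lambda>z. \<Sum>y\<in>F. g y z"
  let ?\<psi> = "\<lambda>y k. \<integral>z. g y z \<partial>T k"
  have P: "prob_space (?q \<beta>)" "sets (?q \<beta>) = sets borel" "prob_space (?A \<beta>)"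
     "sets (?A \<beta>) = sets (sa_space U)" "space (?A \<beta>) = UNIV \<times> U"
    if "\<beta> \<in> stationary_policies U" for \<beta>
    using prob_algebra_borelD[OF policy_operator_in_space[OF T that \<pi>]]
      prob_algebra_saD[OF act_law_in_space[OF that \<pi>]] by auto
  note Tp = transition_kernelD(1)[OF T] and mT = measurable_integral_transition_kernel[OF T]
  have G0: "0 \<le> ?G z" for z using g(3) by (intro sum_nonneg)
  have gb: "\<bar>g y z\<bar> \<le> 1" if "y \<in> F" for y z
    using member_le_sum[of y F "\<lambda>y. g y z"] that g(1,3) g(4)[of z] by (auto simp: order_trans)
  have Gm: "?G \<in> borel_measurable borel" using g(2) by (intro borel_measurable_sum)
  have int: "integrable (?q \<beta>) f" if "\<beta> \<in> stationary_policies U" "f \<in> borel_measurable borel"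
    "\<And>z. \<bar>f z\<bar> \<le> 1" for \<beta> and f :: "'x \<Rightarrow> real"
    using that P(1,2)[OF that(1)] by (intro integrable_bounded_prob[where B=1])
      (auto simp: measurable_cong_sets[OF P(2)[OF that(1)] refl])
  have q\<psi>: "(\<integral>z. g y z \<partial>?q \<beta>) = (\<integral>k. ?\<psi> y k \<partial>?A \<beta>)" if "\<beta> \<in> stationary_policies U" "y \<in> F" for \<beta> y
    by (rule integral_policy_operator[OF T that(1) \<pi> g(2)[OF that(2)] gb[OF that(2)]])
  have tail_eq: "(\<integral>z. 1 - ?G z \<partial>?q \<beta>) = 1 - (\<Sum>y\<in>F. \<integral>k. ?\<psi> y k \<partial>?A \<beta>)"
    if \<beta>: "\<beta> \<in> stationary_policies U" for \<beta>
  proof -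
    interpret q: prob_space "?q \<beta>" by (rule P(1)[OF \<beta>])
    have "integrable (?q \<beta>) (g y)" if "y \<in> F" for y using int[OF \<beta> g(2) gb, OF that that] .
    then show ?thesis using q\<psi>[OF \<beta>] by (simp add: q.prob_space)
  qed
  have tail': "(\<integral>z. 1 - ?G z \<partial>?q \<gamma>') \<le> 2 * \<eta>"
  proof -
    have "(\<Sum>y\<in>F. \<integral>k. ?\<psi> y k \<partial>?A \<gamma>) - (\<Sum>y\<in>F. \<integral>k. ?\<psi> y k \<partial>?A \<gamma>') \<le> \<eta>"
      unfolding sum_subtractf[symmetric]
      by (rule order_trans[OF sum_mono close]) (simp add: abs_minus_commute abs_le_iff)
    then show ?thesis using tail unfolding tail_eq[OF \<gamma>] tail_eq[OF \<gamma>'] by linarith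
  qed
  fix h :: "'x \<Rightarrow> real" assume "h \<in> borel_measurable (?q \<gamma>')" and hb: "\<forall>z. \<bar>h z\<bar> \<le> 1"
  then have h: "h \<in> borel_measurable borel" by (simp only: measurable_cong_sets[OF P(2)[OF \<gamma>'] refl])
  obtain \<theta> where \<theta>: "\<And>y. \<bar>\<theta> y\<bar> \<le> 1" "\<And>k. k \<in> UNIV \<times> U \<Longrightarrow>
     \<bar>(\<integral>z. h z * ?G z \<partial>T k) - (\<Sum>y\<in>F. \<theta> y * ?\<psi> y k)\<bar> \<le> \<eta>"
    using test[OF h] hb by blast
  have hG: "\<bar>h z * ?G z\<bar> \<le> 1" "\<bar>h z * (1 - ?G z)\<bar> \<le> 1 - ?G z" "1 - ?G z \<le> 1" for z
    using mult_mono[of "\<bar>h z\<bar>" 1 "?G z" 1] mult_right_mono[of "\<bar>h z\<bar>" 1 "1 - ?G z"] hb G0[of z] g(4)[of z]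
    by (simp_all add: abs_mult)
  \<comment> \<open>Replacing \<open>h\<close> by the combination of bumps costs \<open>\<eta>\<close>, discarding the part of \<open>h\<close> outside
    them costs the missed mass. In total: \<open>\<eta> + \<eta>\<close> for \<open>\<gamma>\<close>, \<open>\<eta> + 2\<eta>\<close> for \<open>\<gamma>'\<close>, and \<open>\<eta>\<close> between
    the two combinations.\<close>
  have near: "\<bar>(\<integral>z. h z \<partial>?q \<beta>) - (\<Sum>y\<in>F. \<theta> y * (\<integral>k. ?\<psi> y k \<partial>?A \<beta>))\<bar> \<le> \<eta> + (\<integral>z. 1 - ?G z \<partial>?q \<beta>)"
    if \<beta>: "\<beta> \<in> stationary_policies U" for \<beta>
  proof -
    have m1: "(\<lambda>z. h z * ?G z) \<in> borel_measurable borel" "(\<lambda>z. h z * (1 - ?G z)) \<in> borel_measurable borel"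
       "(\<lambda>z. 1 - ?G z) \<in> borel_measurable borel"
      using h Gm by auto
    have b1: "\<bar>1 - ?G z\<bar> \<le> 1" "\<bar>h z * (1 - ?G z)\<bar> \<le> 1" for z
      using hG(2,3)[of z] g(4)[of z] by auto
    have "(\<integral>z. h z \<partial>?q \<beta>) = (\<integral>z. h z * ?G z + h z * (1 - ?G z) \<partial>?q \<beta>)" by (simp add: algebra_simps)
    also have "\<dots> = (\<integral>z. h z * ?G z \<partial>?q \<beta>) + (\<integral>z. h z * (1 - ?G z) \<partial>?q \<beta>)"
      by (intro Bochner_Integration.integral_add int[OF \<beta> m1(1) hG(1)] int[OF \<beta> m1(2) b1(2)])
    finally have split: "(\<integral>z. h z \<partial>?q \<beta>) = (\<integral>z. h z * ?G z \<partial>?q \<beta>) + (\<integral>z. h z * (1 - ?G z) \<partial>?q \<beta>)" .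
    have rest: "\<bar>\<integral>z. h z * (1 - ?G z) \<partial>?q \<beta>\<bar> \<le> (\<integral>z. 1 - ?G z \<partial>?q \<beta>)"
      using int[OF \<beta> m1(2) b1(2)] int[OF \<beta> m1(3) b1(1)] hG(2) by (intro abs_integral_le_integral)
    have i\<psi>: "integrable (?A \<beta>) (?\<psi> y)" if "y \<in> F" for y
      using mT[OF g(2)[OF that]] abs_integral_le_bound[OF Tp gb[OF that]] P(3-5)[OF \<beta>]
      by (intro integrable_bounded_prob[where B=1]) (auto simp: measurable_cong_sets[OF P(4)[OF \<beta>] refl])
    have iG: "integrable (?A \<beta>) (\<lambda>k. \<integral>z. h z * ?G z \<partial>T k)"
      using mT[OF m1(1)] abs_integral_le_bound[OF Tp hG(1)] P(3-5)[OF \<beta>]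
      by (intro integrable_bounded_prob[where B=1]) (auto simp: measurable_cong_sets[OF P(4)[OF \<beta>] refl])
    have "(\<integral>z. h z * ?G z \<partial>?q \<beta>) - (\<Sum>y\<in>F. \<theta> y * (\<integral>k. ?\<psi> y k \<partial>?A \<beta>))
        = (\<integral>k. (\<integral>z. h z * ?G z \<partial>T k) - (\<Sum>y\<in>F. \<theta> y * ?\<psi> y k) \<partial>?A \<beta>)"
      unfolding integral_policy_operator[OF T \<beta> \<pi> m1(1) hG(1)] using iG i\<psi> by simp
    also have "\<bar>\<dots>\<bar> \<le> \<eta>"
      using \<theta>(2) P(3,5)[OF \<beta>] by (intro abs_integral_le_bound) auto
    finally show ?thesis using split rest by linarith
  qed
  have "\<bar>(\<Sum>y\<in>F. \<theta> y * (\<integral>k. ?\<psi> y k \<partial>?A \<gamma>')) - (\<Sum>y\<in>F. \<theta> y * (\<integral>k. ?\<psi> y k \<partial>?A \<gamma>))\<bar> \<le> \<eta>"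
  proof -
    have "\<bar>\<Sum>y\<in>F. \<theta> y * ((\<integral>k. ?\<psi> y k \<partial>?A \<gamma>') - (\<integral>k. ?\<psi> y k \<partial>?A \<gamma>))\<bar>
        \<le> (\<Sum>y\<in>F. \<bar>(\<integral>k. ?\<psi> y k \<partial>?A \<gamma>') - (\<integral>k. ?\<psi> y k \<partial>?A \<gamma>)\<bar>)"
      using mult_right_mono[OF \<theta>(1)] by (intro order_trans[OF sum_abs] sum_mono) (simp add: abs_mult)
    then show ?thesis using close by (simp add: right_diff_distrib sum_subtractf)
  qed
  then show "\<bar>(\<integral>z. h z \<partial>?q \<gamma>') - (\<integral>z. h z \<partial>?q \<gamma>)\<bar> \<le> 6 * \<eta>"
    using near[OF \<gamma>] near[OF \<gamma>'] tail tail' by linarith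
qed

theorem theorem4p2:
  fixes U :: "'u::polish_space set"
    and T :: "(real ^ 'n) \<times> 'u \<Rightarrow> (real ^ 'n) measure"
    and c :: "(real ^ 'n) \<times> 'u \<Rightarrow> real"
    and \<alpha> :: real
    and \<phi> :: "(real ^ 'n) measure"
    and dens :: "(real ^ 'n) \<times> 'u \<Rightarrow> real ^ 'n \<Rightarrow> real"
  assumes kernel: "transition_kernel U T"
    and cost_meas: "c \<in> borel_measurable (sa_space U)"
    and cost_nonneg: "\<And>k. k \<in> UNIV \<times> U \<Longrightarrow> 0 \<le> c k"
    and G_compact: "compactin (weak_topology (UNIV \<times> U)) (invariant_occupation_measures U T)"
    and U_compact: "compact U"
    and alpha: "0 \<le> \<alpha>" "\<alpha> < 1"
    and contraction: "\<And>\<gamma> \<pi> \<pi>'. \<lbrakk>\<gamma> \<in> stationary_policies U;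
          \<pi> \<in> space (prob_algebra borel); \<pi>' \<in> space (prob_algebra borel)\<rbrakk> \<Longrightarrow>
          tv_dist (policy_operator T \<gamma> \<pi>) (policy_operator T \<gamma> \<pi>') \<le> \<alpha> * tv_dist \<pi> \<pi>'"
    and ref_sets: "sets \<phi> = sets borel"
    and ref_atomless: "\<And>y. emeasure \<phi> {y} = 0"
    and density: "\<And>k. k \<in> UNIV \<times> U \<Longrightarrow>
          dens k \<in> borel_measurable borel \<and> (\<forall>y. 0 \<le> dens k y) \<and>
          T k = density \<phi> (\<lambda>y. ennreal (dens k y))"
    and dens_bounded: "\<exists>B. \<forall>k\<in>UNIV \<times> U. \<forall>y. dens k y \<le> B"
    and dens_equicont: "equicontinuous_family (UNIV \<times> U) dens"
    and regularity:
      "(H1 U T \<and> bounded (c ` (UNIV \<times> U)) \<and> continuous_on (UNIV \<times> U) c) \<or>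
       (H2a U T \<and> bounded (c ` (UNIV \<times> U)) \<and> (\<forall>x. continuous_on U (\<lambda>u. c (x, u))))"
  shows "\<forall>\<gamma>\<in>stationary_policies U. \<forall>\<epsilon>>0. \<exists>f\<in>deterministic_policies U.
           finite (range f) \<and>
           (\<forall>x. \<bar>avg_cost U T c x (dirac_policy U f) - avg_cost U T c x \<gamma>\<bar> < ereal \<epsilon>)"
proof (intro ballI allI impI)
  fix \<gamma> :: "real ^ 'n \<Rightarrow> 'u measure" and \<epsilon> :: real
  assume \<gamma>: "\<gamma> \<in> stationary_policies U" and \<epsilon>: "0 < \<epsilon>"
  let ?P = "policy_operator T \<gamma>"
  have pair: "continuous_on U (\<lambda>u. f (x, u))" if "continuous_on (UNIV \<times> U) f"
    for f :: "(real ^ 'n) \<times> 'u \<Rightarrow> real" and x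
    by (rule continuous_on_compose2[OF that]) (auto intro!: continuous_intros)
  \<comment> \<open>From here on the two regularity alternatives are treated alike.\<close>
  have c_cont: "continuous_on U (\<lambda>u. c (x, u))" for x
    using regularity pair[of c x] by auto
  have T_cont: "continuous_on U (\<lambda>u. \<integral>z. g z \<partial>T (x, u))"
    if "continuous_on UNIV g" "bounded (range g)" for g :: "real ^ 'n \<Rightarrow> real" and x
    using regularity pair[of "\<lambda>k. \<integral>z. g z \<partial>T k" x] that borel_measurable_continuous_onI[OF that(1)]
    unfolding H1_def H2a_def by blast
  have "bounded (c ` (UNIV \<times> U))" using regularity by auto
  then obtain C' where "\<And>k. k \<in> UNIV \<times> U \<Longrightarrow> \<bar>c k\<bar> \<le> C'"
    unfolding bounded_iff by auto
  then obtain C where C: "1 \<le> C" "\<And>k. k \<in> UNIV \<times> U \<Longrightarrow> \<bar>c k\<bar> \<le> C"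
    by (metis max.cobounded1 max.coboundedI2 max.commute order_trans)
  note Tp = transition_kernelD(1)[OF kernel]

  \<comment> \<open>One step moves \<open>\<pi>\<close> by at most \<open>\<eta>\<close> under \<open>\<gamma>\<close> and \<open>7 \<eta>\<close> under \<open>f\<close>. With this \<open>\<eta>\<close> the average
    costs differ by at most \<open>(1 + 7 + 1) \<epsilon> / 16\<close>.\<close>
  define \<eta> where "\<eta> = \<epsilon> * (1 - \<alpha>) / (16 * C)"
  have \<eta>: "0 < \<eta>" using \<epsilon> alpha C(1) by (simp add: \<eta>_def)
  obtain N where N: "2 * \<alpha> ^ N \<le> \<eta>"
  proof -
    have "(\<lambda>N. 2 * \<alpha> ^ N) \<longlonglongrightarrow> 2 * 0"
      using alpha by (intro tendsto_mult tendsto_const LIMSEQ_realpow_zero)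
    from order_tendstoD(2)[OF this, of \<eta>] \<eta> obtain n where "2 * \<alpha> ^ n < \<eta>"
      by (auto simp: eventually_sequentially)
    then show ?thesis using that less_imp_le by blast
  qed
  define p where "p n = (?P ^^ n) (return borel 0)" for n
  have p: "p n \<in> space (prob_algebra borel)" for n
    using policy_operator_in_space[OF kernel \<gamma>]
    by (induction n) (auto simp: p_def space_prob_algebra prob_space_return)
  have p_step: "tv_dist (?P (p n)) (p n) \<le> 2 * \<alpha> ^ n" for n
  proof (induction n)
    case 0
    show ?case
      using tv_dist_le_2[OF prob_algebra_borelD(1)[OF p[of 1]] prob_algebra_borelD(1)[OF p[of 0]]]
      by (simp add: p_def)
  next
    case (Suc n)
    have "tv_dist (?P (p (Suc n))) (p (Suc n)) \<le> \<alpha> * tv_dist (?P (p n)) (p n)"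
      using contraction[OF \<gamma> p[of "Suc n"] p[of n]] by (simp add: p_def)
    also have "\<dots> \<le> \<alpha> * (2 * \<alpha> ^ n)" using Suc alpha by (intro mult_left_mono)
    finally show ?case by simp
  qed
  \<comment> \<open>At least one step is taken, since the initial point mass has an atom.\<close>
  define \<pi> where "\<pi> = p (Suc N)"
  have \<pi>: "\<pi> \<in> space (prob_algebra borel)" unfolding \<pi>_def by (rule p)
  have \<pi>_P: "\<pi> = ?P (p N)" by (simp add: \<pi>_def p_def)
  have \<pi>_inv: "tv_dist (?P \<pi>) \<pi> \<le> \<eta>"
  proof -
    have "2 * \<alpha> ^ Suc N \<le> 2 * \<alpha> ^ N" using alpha by (simp add: mult_left_le_one_le)
    then show ?thesis using p_step[of "Suc N"] N unfolding \<pi>_def by linarith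
  qed
  have \<pi>_atomless: "measure \<pi> {y} = 0" for y
    unfolding \<pi>_P
  proof (rule measure_policy_operator_eq_0[OF kernel \<gamma> p])
    fix k :: "(real ^ 'n) \<times> 'u" assume k: "k \<in> UNIV \<times> U"
    have "{y} \<in> null_sets \<phi>" using ref_atomless ref_sets by (intro null_setsI) auto
    moreover have "(\<lambda>y. ennreal (dens k y)) \<in> borel_measurable \<phi>"
      using density[OF k] by (simp add: measurable_cong_sets[OF ref_sets refl])
    ultimately have "{y} \<in> null_sets (density \<phi> (\<lambda>y. ennreal (dens k y)))"
      using absolutely_continuousI_density by (auto simp: absolutely_continuous_def)
    then show "measure (T k) {y} = 0" using density[OF k] by (simp add: measure_eq_0_null_sets)
  qed simp

  have dens: "\<forall>k\<in>UNIV \<times> U. dens k \<in> borel_measurable borel \<and> (\<forall>y. 0 \<le> dens k y) \<and>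
      prob_space (density \<phi> (\<lambda>y. ennreal (dens k y)))"
    using density Tp by metis
  have null: "measure (?P \<pi>) {y. \<forall>k\<in>UNIV \<times> U. dens k y = 0} = 0"
  proof (rule measure_policy_operator_eq_0[OF kernel \<gamma> \<pi>])
    let ?Z = "{y. \<forall>k\<in>UNIV \<times> U. dens k y = 0}"
    have "closed (\<Inter>k\<in>UNIV \<times> U. {y. dens k y = 0})"
      using equicontinuous_family_continuous[OF dens_equicont]
      by (intro closed_INT ballI closed_Collect_eq continuous_on_const) auto
    moreover have "(\<Inter>k\<in>UNIV \<times> U. {y. dens k y = 0}) = ?Z" by auto
    ultimately show Z: "?Z \<in> sets borel" by simp
    fix k :: "(real ^ 'n) \<times> 'u" assume k: "k \<in> UNIV \<times> U"
    have "emeasure (T k) ?Z = (\<integral>\<^sup>+y. ennreal (dens k y) * indicator ?Z y \<partial>\<phi>)"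
      using density[OF k] Z ref_sets by (auto simp: emeasure_density measurable_cong_sets[OF ref_sets refl])
    also have "\<dots> = (\<integral>\<^sup>+y. 0 \<partial>\<phi>)" using k by (intro nn_integral_cong) (auto simp: indicator_def)
    finally show "measure (T k) ?Z = 0" by (simp add: measure_def)
  qed
  from equicontinuous_densities_test_functions[OF ref_sets dens dens_equicont
      policy_operator_in_space[OF kernel \<gamma> \<pi>] null \<eta>]
  obtain F :: "(real ^ 'n) set" and g :: "real ^ 'n \<Rightarrow> real ^ 'n \<Rightarrow> real"
    where Fg: "finite F" "\<forall>y\<in>F. continuous_on UNIV (g y)" "\<forall>y z. 0 \<le> g y z"
    "\<forall>z. (\<Sum>y\<in>F. g y z) \<le> 1" "(\<integral>z. 1 - (\<Sum>y\<in>F. g y z) \<partial>?P \<pi>) \<le> \<eta>"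
    and test: "\<forall>h. h \<in> borel_measurable borel \<longrightarrow> (\<forall>z. \<bar>h z\<bar> \<le> 1) \<longrightarrow> (\<exists>\<theta>. (\<forall>y. \<bar>\<theta> y\<bar> \<le> 1) \<and>
       (\<forall>k\<in>UNIV \<times> U. \<bar>(\<integral>z. h z * (\<Sum>y\<in>F. g y z) \<partial>density \<phi> (\<lambda>y. ennreal (dens k y))) -
          (\<Sum>y\<in>F. \<theta> y * (\<integral>z. g y z \<partial>density \<phi> (\<lambda>y. ennreal (dens k y))))\<bar> \<le> \<eta>))"
    by (elim exE conjE)
  note Fg = Fg(1) Fg(2)[rule_format] Fg(3)[rule_format] Fg(4)[rule_format] Fg(5)
  have g_meas: "g y \<in> borel_measurable borel" if "y \<in> F" for y
    by (rule borel_measurable_continuous_onI[OF Fg(2)[OF that]])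
  have gb: "\<bar>g y z\<bar> \<le> 1" if "y \<in> F" for y z
    using member_le_sum[of y F "\<lambda>y. g y z"] that Fg(1,3) Fg(4)[of z] by (auto simp: order_trans)

  \<comment> \<open>The finitely many functions to be matched: the cost, indexed by \<open>None\<close>, and one for each bump.
    The discrepancies of the latter add up, hence the division by their number.\<close>
  define \<psi> where "\<psi> j = (case j of None \<Rightarrow> c | Some y \<Rightarrow> (\<lambda>k. \<integral>z. g y z \<partial>T k))" for j
  define \<delta> where "\<delta> = \<eta> / real (Suc (card F))"
  have \<delta>: "0 < \<delta>" "\<delta> \<le> \<eta>" "real (card F) * \<delta> \<le> \<eta>"
    using \<eta> by (auto simp: \<delta>_def field_simps)
  have "\<exists>f \<in> deterministic_policies U. finite (range f) \<and>
    (\<forall>j\<in>insert None (Some ` F). \<bar>(\<integral>k. \<psi> j k \<partial>act_law U (dirac_policy U f) \<pi>) - (\<integral>k. \<psi> j k \<partial>act_law U \<gamma> \<pi>)\<bar> \<le> \<delta>)"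
  proof (rule deterministic_approximation[OF \<gamma> \<pi> \<pi>_atomless, where B=C])
    fix j assume j: "j \<in> insert None (Some ` F)"
    show "\<psi> j \<in> borel_measurable (sa_space U)"
      using j cost_meas measurable_integral_transition_kernel[OF kernel g_meas]
      by (auto simp: \<psi>_def)
    show "\<bar>\<psi> j k\<bar> \<le> C" if k: "k \<in> UNIV \<times> U" for k
    proof (cases j)
      case None then show ?thesis using C(2)[OF k] by (simp add: \<psi>_def)
    next
      case (Some y)
      then have "y \<in> F" using j by auto
      then have "\<bar>\<integral>z. g y z \<partial>T k\<bar> \<le> 1" using gb by (intro abs_integral_le_bound Tp k) auto
      then show ?thesis using C(1) Some by (simp add: \<psi>_def)
    qed
    show "continuous_on U (\<lambda>u. \<psi> j (x, u))" for x
    proof (cases j)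
      case None then show ?thesis using c_cont by (simp add: \<psi>_def)
    next
      case (Some y)
      then have "y \<in> F" using j by auto
      then have "bounded (range (g y))" using gb by (auto simp: bounded_iff)
      with T_cont[OF Fg(2)[OF \<open>y \<in> F\<close>]] Some show ?thesis by (simp add: \<psi>_def)
    qed
  qed (use Fg(1) \<delta>(1) in auto)
  then obtain f where f: "f \<in> deterministic_policies U" "finite (range f)"
    and near: "\<And>j. j \<in> insert None (Some ` F) \<Longrightarrow>
      \<bar>(\<integral>k. \<psi> j k \<partial>act_law U (dirac_policy U f) \<pi>) - (\<integral>k. \<psi> j k \<partial>act_law U \<gamma> \<pi>)\<bar> \<le> \<delta>"
    by blast
  let ?f = "dirac_policy U f"
  have f': "?f \<in> stationary_policies U" by (rule dirac_policy_stationary[OF f(1)])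
  have "tv_dist (policy_operator T ?f \<pi>) (?P \<pi>) \<le> 6 * \<eta>"
  proof (rule tv_dist_policy_operator_le[OF kernel \<gamma> f' \<pi> Fg(1) g_meas Fg(3-5)])
    fix h :: "real ^ 'n \<Rightarrow> real" assume "h \<in> borel_measurable borel" "\<And>z. \<bar>h z\<bar> \<le> 1"
    with test show "\<exists>\<theta>. (\<forall>y. \<bar>\<theta> y\<bar> \<le> 1) \<and>
       (\<forall>k\<in>UNIV \<times> U. \<bar>(\<integral>z. h z * (\<Sum>y\<in>F. g y z) \<partial>T k) - (\<Sum>y\<in>F. \<theta> y * (\<integral>z. g y z \<partial>T k))\<bar> \<le> \<eta>)"
      using density by (simp cong: ball_cong)
  next
    have "(\<Sum>y\<in>F. \<bar>(\<integral>k. (\<integral>z. g y z \<partial>T k) \<partial>act_law U ?f \<pi>) - (\<integral>k. (\<integral>z. g y z \<partial>T k) \<partial>act_law U \<gamma> \<pi>)\<bar>)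
        \<le> (\<Sum>y\<in>F. \<delta>)"
      using near[of "Some _"] by (intro sum_mono) (simp add: \<psi>_def)
    then show "(\<Sum>y\<in>F. \<bar>(\<integral>k. (\<integral>z. g y z \<partial>T k) \<partial>act_law U ?f \<pi>) - (\<integral>k. (\<integral>z. g y z \<partial>T k) \<partial>act_law U \<gamma> \<pi>)\<bar>) \<le> \<eta>"
      using \<delta>(3) by simp
  qed
  then have f_inv: "tv_dist (policy_operator T ?f \<pi>) \<pi> \<le> 7 * \<eta>"
    using tv_dist_triangle[of "policy_operator T ?f \<pi>" "?P \<pi>" \<pi>] \<pi>_inv
      prob_algebra_borelD[OF policy_operator_in_space[OF kernel f' \<pi>]]
      prob_algebra_borelD[OF policy_operator_in_space[OF kernel \<gamma> \<pi>]] prob_algebra_borelD[OF \<pi>] by simp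
  have C0: "0 < C" "\<And>k. k \<in> UNIV \<times> U \<Longrightarrow> c k \<le> C" using C by (auto simp: abs_le_iff)
  have "\<bar>avg_cost U T c x ?f - avg_cost U T c x \<gamma>\<bar> < ereal \<epsilon>" for x
  proof -
    obtain L1 where L1: "avg_cost U T c x ?f = ereal L1"
      "\<bar>L1 - (\<integral>k. c k \<partial>act_law U ?f \<pi>)\<bar> \<le> C * (7 * \<eta>) / (1 - \<alpha>)"
      using avg_cost_near_act_law_integral[OF kernel f' alpha contraction[OF f'] \<pi> f_inv cost_meas cost_nonneg C0(2,1)] .
    obtain L2 where L2: "avg_cost U T c x \<gamma> = ereal L2"
      "\<bar>L2 - (\<integral>k. c k \<partial>act_law U \<gamma> \<pi>)\<bar> \<le> C * \<eta> / (1 - \<alpha>)"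
      using avg_cost_near_act_law_integral[OF kernel \<gamma> alpha contraction[OF \<gamma>] \<pi> \<pi>_inv cost_meas cost_nonneg C0(2,1)] .
    have "\<bar>(\<integral>k. c k \<partial>act_law U ?f \<pi>) - (\<integral>k. c k \<partial>act_law U \<gamma> \<pi>)\<bar> \<le> \<eta>"
      using near[of None] \<delta>(2) by (simp add: \<psi>_def)
    moreover have "C * \<eta> / (1 - \<alpha>) = \<epsilon> / 16" "C * (7 * \<eta>) / (1 - \<alpha>) = 7 * \<epsilon> / 16"
      using C(1) alpha by (simp_all add: \<eta>_def field_simps)
    moreover have "\<eta> \<le> \<epsilon> / 16"
    proof -
      have "\<epsilon> * (1 - \<alpha>) \<le> \<epsilon> * C" using \<epsilon> alpha C(1) by (intro mult_left_mono) auto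
      then show ?thesis using C(1) by (simp add: \<eta>_def field_simps)
    qed
    ultimately have "\<bar>L1 - L2\<bar> < \<epsilon>" using L1(2) L2(2) \<epsilon> by linarith
    then show ?thesis using L1(1) L2(1) by simp
  qed
  with f show "\<exists>f\<in>deterministic_policies U. finite (range f) \<and>
      (\<forall>x. \<bar>avg_cost U T c x (dirac_policy U f) - avg_cost U T c x \<gamma>\<bar> < ereal \<epsilon>)"
    by blast
qed

end
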